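(* Let $S$ be a completely regular semigroup. Then $\pi_t=((\omega_t)_k)_t$ is the least congruence $\rho$ on $S$ for which $\ker\sigma_{S/\rho}$ is a cryptogroup.
   Context: A completely regular semigroup is a semigroup that is a union of its subgroups. A cryptogroup is a completely regular semigroup on which Green's relation $\mathcal{H}$ is a congruence. $E(S)$ is the set of idempotents of $S$ and $\omega$ is the universal relation on $S$. For a congruence $\rho$ on $S$: $\operatorname{tr}\rho=\rho|_{E(S)}$ and $\ker\rho=\{a\in S: a\,\rho\,e\text{ for some }e\in E(S)\}$; $\rho_t$ (resp. $\rho_k$) denotes the least congruence on $S$ with the same trace (resp. the same kernel) as $\rho$. A regular semigroup $T$ is $E$-unitary if $e\in E(T)$ and $ea\in E(T)$ (equivalently, $ae\in E(T)$) imply $a\in E(T)$. $\pi$ is the least congruence on $S$ with $E$-unitary quotient; $\pi=(\omega_t)_k$. For a completely regular semigroup $T$, $\sigma_T$ is the least congruence on $T$ whose quotient is a group; $\ker\sigma_T$ is a completely regular subsemigroup of $T$. *)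

theory Defs
  imports "HOL-Algebra.Group"
begin

record 'a sgrp = "'a partial_object" +
  sg_mult :: "['a, 'a] \<Rightarrow> 'a" (infixl "\<cdot>\<index>" 70)

text \<open>Semigroups are nonempty, as usual in semigroup theory.\<close>

locale sgrp =
  fixes S :: "'a sgrp" (structure)
  assumes nonempty: "carrier S \<noteq> {}"
    and closed: "\<lbrakk>x \<in> carrier S; y \<in> carrier S\<rbrakk> \<Longrightarrow> x \<cdot> y \<in> carrier S"
    and assoc: "\<lbrakk>x \<in> carrier S; y \<in> carrier S; z \<in> carrier S\<rbrakk> \<Longrightarrow> (x \<cdot> y) \<cdot> z = x \<cdot> (y \<cdot> z)"

abbreviation restrict_to :: "'a sgrp \<Rightarrow> 'a set \<Rightarrow> 'a sgrp" where
  "restrict_to S A \<equiv> S\<lparr>carrier := A\<rparr>"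

definition is_group :: "'a sgrp \<Rightarrow> bool" where
  "is_group S \<longleftrightarrow> (\<exists>e. group \<lparr>carrier = carrier S, mult = sg_mult S, one = e\<rparr>)"

definition idempotents :: "'a sgrp \<Rightarrow> 'a set" where
  "idempotents S = {e \<in> carrier S. e \<cdot>\<^bsub>S\<^esub> e = e}"

definition regular :: "'a sgrp \<Rightarrow> bool" where
  "regular S \<longleftrightarrow> sgrp S \<and> (\<forall>a\<in>carrier S. \<exists>x\<in>carrier S. a \<cdot>\<^bsub>S\<^esub> x \<cdot>\<^bsub>S\<^esub> a = a)"

definition completely_regular :: "'a sgrp \<Rightarrow> bool" where
  "completely_regular S \<longleftrightarrow>
     sgrp S \<and> carrier S = \<Union>{G. G \<subseteq> carrier S \<and> is_group (restrict_to S G)}"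

definition E_unitary :: "'a sgrp \<Rightarrow> bool" where
  "E_unitary S \<longleftrightarrow> regular S \<and>
     (\<forall>e\<in>idempotents S. \<forall>a\<in>carrier S. e \<cdot>\<^bsub>S\<^esub> a \<in> idempotents S \<longrightarrow> a \<in> idempotents S)"

text \<open>The principal one-sided ideals \<open>S\<^sup>1 a\<close> and \<open>a S\<^sup>1\<close>.\<close>

definition left_ideal :: "'a sgrp \<Rightarrow> 'a \<Rightarrow> 'a set" where
  "left_ideal S a = insert a {x \<cdot>\<^bsub>S\<^esub> a | x. x \<in> carrier S}"

definition right_ideal :: "'a sgrp \<Rightarrow> 'a \<Rightarrow> 'a set" where
  "right_ideal S a = insert a {a \<cdot>\<^bsub>S\<^esub> x | x. x \<in> carrier S}"

definition green_L :: "'a sgrp \<Rightarrow> 'a rel" where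
  "green_L S = {(a, b) \<in> carrier S \<times> carrier S. left_ideal S a = left_ideal S b}"

definition green_R :: "'a sgrp \<Rightarrow> 'a rel" where
  "green_R S = {(a, b) \<in> carrier S \<times> carrier S. right_ideal S a = right_ideal S b}"

definition green_H :: "'a sgrp \<Rightarrow> 'a rel" where
  "green_H S = green_L S \<inter> green_R S"

definition sg_congruence :: "'a sgrp \<Rightarrow> 'a rel \<Rightarrow> bool" where
  "sg_congruence S \<rho> \<longleftrightarrow> equiv (carrier S) \<rho> \<and>
     (\<forall>(a, b)\<in>\<rho>. \<forall>c\<in>carrier S. (c \<cdot>\<^bsub>S\<^esub> a, c \<cdot>\<^bsub>S\<^esub> b) \<in> \<rho> \<and> (a \<cdot>\<^bsub>S\<^esub> c, b \<cdot>\<^bsub>S\<^esub> c) \<in> \<rho>)"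

definition cryptogroup :: "'a sgrp \<Rightarrow> bool" where
  "cryptogroup S \<longleftrightarrow> completely_regular S \<and> sg_congruence S (green_H S)"

definition quotient_sgrp :: "'a sgrp \<Rightarrow> 'a rel \<Rightarrow> 'a set sgrp" where
  "quotient_sgrp S \<rho> =
     \<lparr>carrier = carrier S // \<rho>,
      sg_mult = (\<lambda>X Y. \<Union>x\<in>X. \<Union>y\<in>Y. \<rho> `` {x \<cdot>\<^bsub>S\<^esub> y})\<rparr>"

definition cong_tr :: "'a sgrp \<Rightarrow> 'a rel \<Rightarrow> 'a rel" where
  "cong_tr S \<rho> = \<rho> \<inter> (idempotents S \<times> idempotents S)"

definition cong_ker :: "'a sgrp \<Rightarrow> 'a rel \<Rightarrow> 'a set" where
  "cong_ker S \<rho> = {a \<in> carrier S. \<exists>e\<in>idempotents S. (a, e) \<in> \<rho>}"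

definition is_least_congruence :: "'a sgrp \<Rightarrow> ('a rel \<Rightarrow> bool) \<Rightarrow> 'a rel \<Rightarrow> bool" where
  "is_least_congruence S P \<rho> \<longleftrightarrow> sg_congruence S \<rho> \<and> P \<rho> \<and>
     (\<forall>\<tau>. sg_congruence S \<tau> \<longrightarrow> P \<tau> \<longrightarrow> \<rho> \<subseteq> \<tau>)"

text \<open>A least element is unique, so the definite description below denotes it as soon as it
  exists. Where no least congruence with the property exists, the value is unspecified.\<close>

definition least_congruence :: "'a sgrp \<Rightarrow> ('a rel \<Rightarrow> bool) \<Rightarrow> 'a rel" where
  "least_congruence S P = (THE \<rho>. is_least_congruence S P \<rho>)"

lemma least_congruence_eqI:
  "is_least_congruence S P \<rho> \<Longrightarrow> least_congruence S P = \<rho>"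
  unfolding least_congruence_def
  by (rule the_equality) (auto simp: is_least_congruence_def)


definition universal_cong :: "'a sgrp \<Rightarrow> 'a rel" where
  "universal_cong S = carrier S \<times> carrier S"

text \<open>The congruences \<open>\<rho>\<^sub>t\<close> and \<open>\<rho>\<^sub>k\<close>.\<close>

definition lower_t :: "'a sgrp \<Rightarrow> 'a rel \<Rightarrow> 'a rel" where
  "lower_t S \<rho> = least_congruence S (\<lambda>\<tau>. cong_tr S \<tau> = cong_tr S \<rho>)"

definition lower_k :: "'a sgrp \<Rightarrow> 'a rel \<Rightarrow> 'a rel" where
  "lower_k S \<rho> = least_congruence S (\<lambda>\<tau>. cong_ker S \<tau> = cong_ker S \<rho>)"

definition least_E_unitary_cong :: "'a sgrp \<Rightarrow> 'a rel" where
  "least_E_unitary_cong S = least_congruence S (\<lambda>\<tau>. E_unitary (quotient_sgrp S \<tau>))"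

definition least_group_cong :: "'a sgrp \<Rightarrow> 'a rel" where
  "least_group_cong S = least_congruence S (\<lambda>\<tau>. is_group (quotient_sgrp S \<tau>))"

text \<open>The kernel of the least group congruence, as a semigroup under the restricted operation.\<close>

definition ker_sigma :: "'a sgrp \<Rightarrow> 'a sgrp" where
  "ker_sigma T = restrict_to T (cong_ker T (least_group_cong T))"

end

theory Submission
  imports Defs
begin

text \<open>Write \<open>a\<^sup>0\<close> for the identity of the maximal subgroup containing \<open>a\<close>, so that \<open>a \<H> b\<close> means
  \<open>a\<^sup>0 = b\<^sup>0\<close>, and \<open>\<sigma> = \<omega>\<^sub>t\<close> for the least group congruence. A congruence has an
  \<open>E\<close>-unitary quotient iff its kernel contains \<open>ker \<sigma>\<close>, so \<open>\<pi> = \<sigma>\<^sub>k\<close>. In \<open>T = S/\<pi>\<^sub>t\<close> the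
  congruence \<open>\<pi>/\<pi>\<^sub>t\<close> separates idempotents, and its kernel is \<open>ker \<sigma>\<^sub>T\<close>; hence it restricts on
  \<open>ker \<sigma>\<^sub>T\<close> to \<open>\<H>\<close>, which is therefore a congruence. Conversely, if \<open>ker \<sigma>\<^sub>T\<close> is a cryptogroup for
  \<open>T = S/\<rho>\<close>, then \<open>\<H> \<inter> \<sigma>\<^sub>T\<close> is an idempotent-separating congruence on \<open>T\<close> with kernel
  \<open>ker \<sigma>\<^sub>T\<close>. Its preimage in \<open>S\<close> has the trace of \<open>\<rho>\<close> and an \<open>E\<close>-unitary quotient, so it
  contains \<open>\<pi>\<close>; thus \<open>tr \<pi> \<subseteq> tr \<rho>\<close> and \<open>\<pi>\<^sub>t \<subseteq> \<rho>\<close>.\<close>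

section \<open>Completely regular semigroups\<close>

text \<open>The equations determine \<open>x\<close> as the inverse of \<open>a\<close> in its
  maximal subgroup, so that subgroup need not be named. They are nested to the right, the normal
  form under \<open>assoc\<close> as a simp rule.\<close>

definition grp_inv :: "'a sgrp \<Rightarrow> 'a \<Rightarrow> 'a" where
  "grp_inv S a = (SOME x. x \<in> carrier S \<and> a \<cdot>\<^bsub>S\<^esub> (x \<cdot>\<^bsub>S\<^esub> a) = a \<and> x \<cdot>\<^bsub>S\<^esub> (a \<cdot>\<^bsub>S\<^esub> x) = x \<and> a \<cdot>\<^bsub>S\<^esub> x = x \<cdot>\<^bsub>S\<^esub> a)"

definition grp_id :: "'a sgrp \<Rightarrow> 'a \<Rightarrow> 'a" where
  "grp_id S a = a \<cdot>\<^bsub>S\<^esub> grp_inv S a"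

locale creg =
  fixes S :: "'a sgrp" (structure)
  assumes completely_regular: "completely_regular S"
begin

abbreviation inv_in ("\<iota>") where "\<iota> \<equiv> grp_inv S"
abbreviation id_in ("\<epsilon>") where "\<epsilon> \<equiv> grp_id S"

sublocale sgrp S
  using completely_regular by (simp add: completely_regular_def)

lemma inv_exists:
  assumes "a \<in> carrier S"
  shows "\<exists>x. x \<in> carrier S \<and> a \<cdot> (x \<cdot> a) = a \<and> x \<cdot> (a \<cdot> x) = x \<and> a \<cdot> x = x \<cdot> a"
proof -
  obtain G where G: "G \<subseteq> carrier S" "is_group (restrict_to S G)" "a \<in> G"
    using assms completely_regular unfolding completely_regular_def by blast
  then obtain e where "group \<lparr>carrier = G, mult = sg_mult S, one = e\<rparr>" (is "group ?G")
    by (auto simp: is_group_def)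
  then interpret G: group ?G .
  have a: "a \<in> carrier ?G" using G by simp
  let ?x = "inv\<^bsub>?G\<^esub> a"
  have x: "?x \<in> carrier ?G" using a by (rule G.inv_closed)
  have "a \<cdot> ?x = e" "?x \<cdot> a = e"
    using G.r_inv[OF a] G.l_inv[OF a] by simp_all
  moreover have "a \<cdot> e = a" "?x \<cdot> e = ?x"
    using G.r_one[OF a] G.r_one[OF x] by simp_all
  ultimately show ?thesis using x G(1) by (intro exI[of _ ?x]) auto
qed

lemma
  assumes "a \<in> carrier S"
  shows inv_carrier [simp]: "\<iota> a \<in> carrier S"
    and mult_inv_mult [simp]: "a \<cdot> (\<iota> a \<cdot> a) = a"
    and inv_mult_inv [simp]: "\<iota> a \<cdot> (a \<cdot> \<iota> a) = \<iota> a"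
    and inv_commute: "a \<cdot> \<iota> a = \<iota> a \<cdot> a"
  using someI_ex[OF inv_exists[OF assms]] unfolding grp_inv_def by blast+

declare closed [simp] assoc [simp]

lemma id_carrier [simp]: "a \<in> carrier S \<Longrightarrow> \<epsilon> a \<in> carrier S"
  by (simp add: grp_id_def)

lemma mult_inv: "a \<in> carrier S \<Longrightarrow> a \<cdot> \<iota> a = \<epsilon> a"
  and inv_mult: "a \<in> carrier S \<Longrightarrow> \<iota> a \<cdot> a = \<epsilon> a"
  by (simp_all add: grp_id_def inv_commute)

lemma id_idem [simp]: "a \<in> carrier S \<Longrightarrow> \<epsilon> a \<cdot> \<epsilon> a = \<epsilon> a"
  by (simp add: grp_id_def)

lemma id_mult [simp]: "a \<in> carrier S \<Longrightarrow> \<epsilon> a \<cdot> a = a"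
  and mult_id [simp]: "a \<in> carrier S \<Longrightarrow> a \<cdot> \<epsilon> a = a"
  by (simp add: grp_id_def) (metis inv_mult mult_inv_mult grp_id_def)

lemma id_inv [simp]: "a \<in> carrier S \<Longrightarrow> \<epsilon> a \<cdot> \<iota> a = \<iota> a"
  and inv_id [simp]: "a \<in> carrier S \<Longrightarrow> \<iota> a \<cdot> \<epsilon> a = \<iota> a"
   apply (metis assoc inv_carrier inv_mult inv_mult_inv grp_id_def)
  by (simp add: grp_id_def)

text \<open>Right nesting hides products such as \<open>a \<cdot> \<iota> a\<close> when another
  factor follows; these versions carry that trailing factor.\<close>

lemma mult_inv' [simp]: "\<lbrakk>a \<in> carrier S; b \<in> carrier S\<rbrakk> \<Longrightarrow> a \<cdot> (\<iota> a \<cdot> b) = \<epsilon> a \<cdot> b"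
  and inv_mult' [simp]: "\<lbrakk>a \<in> carrier S; b \<in> carrier S\<rbrakk> \<Longrightarrow> \<iota> a \<cdot> (a \<cdot> b) = \<epsilon> a \<cdot> b"
  and id_idem' [simp]: "\<lbrakk>a \<in> carrier S; b \<in> carrier S\<rbrakk> \<Longrightarrow> \<epsilon> a \<cdot> (\<epsilon> a \<cdot> b) = \<epsilon> a \<cdot> b"
  and id_mult' [simp]: "\<lbrakk>a \<in> carrier S; b \<in> carrier S\<rbrakk> \<Longrightarrow> \<epsilon> a \<cdot> (a \<cdot> b) = a \<cdot> b"
  and mult_id' [simp]: "\<lbrakk>a \<in> carrier S; b \<in> carrier S\<rbrakk> \<Longrightarrow> a \<cdot> (\<epsilon> a \<cdot> b) = a \<cdot> b"
  and id_inv' [simp]: "\<lbrakk>a \<in> carrier S; b \<in> carrier S\<rbrakk> \<Longrightarrow> \<epsilon> a \<cdot> (\<iota> a \<cdot> b) = \<iota> a \<cdot> b"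
  and inv_id' [simp]: "\<lbrakk>a \<in> carrier S; b \<in> carrier S\<rbrakk> \<Longrightarrow> \<iota> a \<cdot> (\<epsilon> a \<cdot> b) = \<iota> a \<cdot> b"
  by (simp_all flip: assoc add: mult_inv inv_mult)

declare mult_inv [simp] inv_mult [simp]

text \<open>Any commuting inner inverse \<open>x\<close> yields the identity: writing
  \<open>a\<close> as \<open>x a a\<close> turns \<open>a \<cdot> \<iota> a\<close> into
  \<open>x a\<close>. Identities in quotients and in \<open>ker_sigma\<close> are computed this
  way.\<close>

lemma id_eqI:
  assumes a: "a \<in> carrier S" and x: "x \<in> carrier S" and axa: "a \<cdot> (x \<cdot> a) = a" and ax: "a \<cdot> x = x \<cdot> a"
  shows "\<epsilon> a = a \<cdot> x"
proof -
  have "\<epsilon> a = (a \<cdot> (x \<cdot> a)) \<cdot> \<iota> a" using axa a by simp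
  also have "\<dots> = (x \<cdot> a) \<cdot> (a \<cdot> \<iota> a)" using a x ax assoc by (metis closed inv_carrier)
  also have "\<dots> = x \<cdot> a" using a x by simp
  finally show ?thesis using ax by simp
qed

lemma idempotents_iff: "e \<in> idempotents S \<longleftrightarrow> e \<in> carrier S \<and> \<epsilon> e = e"
  by (auto simp: idempotents_def id_eqI) (metis id_idem)

lemma idempotent_carrier: "e \<in> idempotents S \<Longrightarrow> e \<in> carrier S"
  by (simp add: idempotents_iff)

lemma id_idempotent [simp]: "a \<in> carrier S \<Longrightarrow> \<epsilon> a \<in> idempotents S"
  by (simp add: idempotents_def)

text \<open>One factor of \<open>a\<close> cancels on multiplication by
  \<open>\<iota> a\<close>.\<close>

lemma idempotentI_cube:
  assumes a: "a \<in> carrier S" and *: "a \<cdot> (a \<cdot> a) = a \<cdot> a"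
  shows "a \<in> idempotents S"
proof -
  have "\<iota> a \<cdot> (a \<cdot> (a \<cdot> a)) = \<iota> a \<cdot> (a \<cdot> a)" using * by simp
  then show ?thesis using a by (simp add: idempotents_def)
qed

text \<open>In any semigroup \<open>(y x)(y x)(y x) = y (x y)(x y) x = y (x y) x\<close>; complete
  regularity then cancels a factor.\<close>

lemma idempotent_swap:
  assumes "x \<in> carrier S" "y \<in> carrier S" "x \<cdot> y \<in> idempotents S"
  shows "y \<cdot> x \<in> idempotents S"
proof (rule idempotentI_cube)
  have "x \<cdot> (y \<cdot> (x \<cdot> y)) = x \<cdot> y" using assms by (simp add: idempotents_def)
  then have "y \<cdot> ((x \<cdot> (y \<cdot> (x \<cdot> y))) \<cdot> x) = y \<cdot> ((x \<cdot> y) \<cdot> x)" by simp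
  then show "y \<cdot> x \<cdot> (y \<cdot> x \<cdot> (y \<cdot> x)) = y \<cdot> x \<cdot> (y \<cdot> x)" using assms by simp
qed (use assms in simp)

text \<open>Both elements lie in one maximal subgroup, where \<open>b \<cdot> \<iota> a\<close>
  inverts \<open>a \<cdot> \<iota> b\<close>.\<close>

lemma id_mult_inv:
  assumes "a \<in> carrier S" "b \<in> carrier S" "\<epsilon> a = \<epsilon> b"
  shows "\<epsilon> (a \<cdot> \<iota> b) = \<epsilon> b" "\<epsilon> (\<iota> b \<cdot> a) = \<epsilon> b"
proof -
  have *: "\<epsilon> b \<cdot> a = a" "a \<cdot> \<epsilon> b = a" "\<epsilon> b \<cdot> \<iota> a = \<iota> a" "\<iota> a \<cdot> \<epsilon> b = \<iota> a"
    using assms by (metis id_mult mult_id id_inv inv_id)+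
  have **: "\<epsilon> b \<cdot> (a \<cdot> c) = a \<cdot> c" "\<epsilon> b \<cdot> (\<iota> a \<cdot> c) = \<iota> a \<cdot> c" if "c \<in> carrier S" for c
    using * that assms by (metis assoc inv_carrier id_carrier)+
  show "\<epsilon> (a \<cdot> \<iota> b) = \<epsilon> b"
    by (subst id_eqI[where x = "b \<cdot> \<iota> a"]) (use assms in \<open>simp_all add: * **\<close>)
  show "\<epsilon> (\<iota> b \<cdot> a) = \<epsilon> b"
    by (subst id_eqI[where x = "\<iota> a \<cdot> b"]) (use assms in \<open>simp_all add: * **\<close>)
qed

lemma regular: "regular S"
  unfolding regular_def using sgrp_axioms by (metis mult_inv_mult inv_carrier assoc)

text \<open>The four factorizations say that \<open>x\<close> and \<open>y\<close> are \<open>\<L>\<close>- and \<open>\<R>\<close>-related.\<close>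

lemma id_eq_if_factor:
  assumes "x \<in> carrier S" "y \<in> carrier S" "u \<in> carrier S" "v \<in> carrier S" "u' \<in> carrier S" "v' \<in> carrier S"
    and "x = u \<cdot> y" "y = v \<cdot> x" "x = y \<cdot> u'" "y = x \<cdot> v'"
  shows "\<epsilon> x = \<epsilon> y"
proof -
  \<comment> \<open>A left multiple of \<open>y\<close> is fixed by \<open>\<epsilon> y\<close> on
    the right, and a right multiple of \<open>x\<close> by \<open>\<epsilon> x\<close> on the left.
    So \<open>\<epsilon> x \<cdot> \<epsilon> y\<close> equals both \<open>\<epsilon> x\<close> and
    \<open>\<epsilon> y\<close>.\<close>
  have "x \<cdot> \<epsilon> y = x" using assms by (metis assoc mult_id id_carrier)
  then have "\<epsilon> x \<cdot> \<epsilon> y = \<epsilon> x"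
    using assms by (metis assoc inv_mult id_carrier inv_carrier)
  moreover have "\<epsilon> x \<cdot> y = y" using assms by (metis assoc id_mult id_carrier)
  then have "\<epsilon> x \<cdot> \<epsilon> y = \<epsilon> y"
    using assms by (metis assoc mult_inv id_carrier inv_carrier)
  ultimately show ?thesis by simp
qed

text \<open>The bridge from principal ideals to equations: all later reasoning about \<H> uses
  identities only.\<close>

lemma green_H_iff: "(a, b) \<in> green_H S \<longleftrightarrow> a \<in> carrier S \<and> b \<in> carrier S \<and> \<epsilon> a = \<epsilon> b"
proof (intro iffI conjI; (elim conjE)?)
  assume H: "(a, b) \<in> green_H S"
  then show ab: "a \<in> carrier S" "b \<in> carrier S"
    by (auto simp: green_H_def green_L_def)
  have "a \<in> left_ideal S b" "b \<in> left_ideal S a" "a \<in> right_ideal S b" "b \<in> right_ideal S a"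
    using H unfolding green_H_def green_L_def green_R_def left_ideal_def right_ideal_def by blast+
  \<comment> \<open>When membership comes from the adjoined generator, so that \<open>a = b\<close>,
    the identity \<open>\<epsilon> a\<close> serves as the factor.\<close>
  then obtain u v u' v' where "u \<in> carrier S" "v \<in> carrier S" "u' \<in> carrier S" "v' \<in> carrier S"
    "a = u \<cdot> b" "b = v \<cdot> a" "a = b \<cdot> u'" "b = a \<cdot> v'"
    using ab unfolding left_ideal_def right_ideal_def
    by (smt (verit) insertE mem_Collect_eq id_carrier id_mult mult_id)
  then show "\<epsilon> a = \<epsilon> b" using ab id_eq_if_factor by blast
next
  assume ab: "a \<in> carrier S" "b \<in> carrier S" "\<epsilon> a = \<epsilon> b"
  have L: "left_ideal S a \<subseteq> left_ideal S b" if "a \<in> carrier S" "b \<in> carrier S" "\<epsilon> a = \<epsilon> b" for a b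
  proof -
    have "a = (a \<cdot> \<iota> b) \<cdot> b" using that mult_id[of a] by simp
    with that show ?thesis unfolding left_ideal_def by (auto; metis assoc closed inv_carrier)
  qed
  have R: "right_ideal S a \<subseteq> right_ideal S b" if "a \<in> carrier S" "b \<in> carrier S" "\<epsilon> a = \<epsilon> b" for a b
  proof -
    have "a = b \<cdot> (\<iota> b \<cdot> a)" using that id_mult[of a] by simp
    with that show ?thesis unfolding right_ideal_def by (auto; metis assoc closed inv_carrier)
  qed
  show "(a, b) \<in> green_H S"
    using L[OF ab] R[OF ab] L[of b a] R[of b a] ab
    by (auto simp: green_H_def green_L_def green_R_def)
qed

end

text \<open>With \<open>e = a x\<close> idempotent, \<open>a\<close> is a unit of the local monoid
  \<open>e S e\<close>, and these units form a subgroup. The criterion is equational, so it passes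
  easily to quotients and to \<open>ker_sigma\<close>.\<close>

lemma completely_regularI:
  assumes "sgrp S"
    and ex: "\<And>a. a \<in> carrier S \<Longrightarrow> \<exists>x\<in>carrier S. a \<cdot>\<^bsub>S\<^esub> (x \<cdot>\<^bsub>S\<^esub> a) = a \<and> a \<cdot>\<^bsub>S\<^esub> x = x \<cdot>\<^bsub>S\<^esub> a"
  shows "completely_regular S"
proof -
  interpret sgrp S by fact
  note [simp] = closed assoc
  have "\<exists>G. G \<subseteq> carrier S \<and> is_group (restrict_to S G) \<and> a \<in> G" if a: "a \<in> carrier S" for a
  proof -
    obtain x where x: "x \<in> carrier S" "a \<cdot>\<^bsub>S\<^esub> (x \<cdot>\<^bsub>S\<^esub> a) = a" "a \<cdot>\<^bsub>S\<^esub> x = x \<cdot>\<^bsub>S\<^esub> a"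
      using ex[OF a] by blast
    define e where "e = a \<cdot>\<^bsub>S\<^esub> x"
    have e: "e \<in> carrier S" "e \<cdot>\<^bsub>S\<^esub> e = e" "e \<cdot>\<^bsub>S\<^esub> a = a" "a \<cdot>\<^bsub>S\<^esub> e = a"
      using a x unfolding e_def by (simp_all, metis a assoc x)
    \<comment> \<open>The group of units of \<open>e S e\<close>.\<close>
    define G where "G = {b \<in> carrier S. e \<cdot>\<^bsub>S\<^esub> b = b \<and> b \<cdot>\<^bsub>S\<^esub> e = b \<and>
      (\<exists>c\<in>carrier S. e \<cdot>\<^bsub>S\<^esub> c = c \<and> c \<cdot>\<^bsub>S\<^esub> e = c \<and> b \<cdot>\<^bsub>S\<^esub> c = e \<and> c \<cdot>\<^bsub>S\<^esub> b = e)}"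
    have "group \<lparr>carrier = G, mult = sg_mult S, one = e\<rparr>"
    proof (rule groupI; simp)
      show "b \<cdot>\<^bsub>S\<^esub> c \<in> G" if "b \<in> G" "c \<in> G" for b c
      proof -
        obtain b' where "b' \<in> carrier S" "e \<cdot>\<^bsub>S\<^esub> b' = b'" "b' \<cdot>\<^bsub>S\<^esub> e = b'"
          "b \<cdot>\<^bsub>S\<^esub> b' = e" "b' \<cdot>\<^bsub>S\<^esub> b = e"
          using \<open>b \<in> G\<close> unfolding G_def by blast
        moreover obtain c' where "c' \<in> carrier S" "e \<cdot>\<^bsub>S\<^esub> c' = c'" "c' \<cdot>\<^bsub>S\<^esub> e = c'"
          "c \<cdot>\<^bsub>S\<^esub> c' = e" "c' \<cdot>\<^bsub>S\<^esub> c = e"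
          using \<open>c \<in> G\<close> unfolding G_def by blast
        moreover have "b \<in> carrier S" "e \<cdot>\<^bsub>S\<^esub> b = b" "b \<cdot>\<^bsub>S\<^esub> e = b" "c \<in> carrier S" "e \<cdot>\<^bsub>S\<^esub> c = c" "c \<cdot>\<^bsub>S\<^esub> e = c"
          using that unfolding G_def by blast+
        ultimately show ?thesis
          unfolding G_def using e by (auto intro!: bexI[of _ "c' \<cdot>\<^bsub>S\<^esub> b'"]) (metis assoc closed)+
      qed
      show "e \<in> G" using e by (auto simp: G_def)
      show "b \<cdot>\<^bsub>S\<^esub> c \<cdot>\<^bsub>S\<^esub> d = b \<cdot>\<^bsub>S\<^esub> (c \<cdot>\<^bsub>S\<^esub> d)" if "b \<in> G" "c \<in> G" "d \<in> G" for b c d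
        using that by (simp add: G_def)
      show "e \<cdot>\<^bsub>S\<^esub> b = b" if "b \<in> G" for b using that by (simp add: G_def)
      show "\<exists>c\<in>G. c \<cdot>\<^bsub>S\<^esub> b = e" if "b \<in> G" for b using that unfolding G_def by blast
    qed
    moreover have "a \<in> G"
    proof -
      \<comment> \<open>The element \<open>x\<close> may lie outside \<open>e S e\<close>; its
        compression lies inside and still inverts \<open>a\<close>.\<close>
      let ?c = "e \<cdot>\<^bsub>S\<^esub> (x \<cdot>\<^bsub>S\<^esub> e)"
      have "a \<cdot>\<^bsub>S\<^esub> ?c = e" "?c \<cdot>\<^bsub>S\<^esub> a = e"
        using a x e by (simp_all flip: assoc) (simp_all add: e_def x)
      then show ?thesis unfolding G_def using a x e
        by (auto intro!: bexI[of _ ?c]) (metis assoc closed)+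
    qed
    ultimately show ?thesis by (intro exI[of _ G]) (auto simp: is_group_def G_def)
  qed
  then show ?thesis unfolding completely_regular_def using sgrp_axioms by blast
qed

section \<open>Congruences\<close>

lemma sg_congruenceI:
  assumes "\<tau> \<subseteq> carrier S \<times> carrier S"
    and "\<And>a. a \<in> carrier S \<Longrightarrow> (a, a) \<in> \<tau>"
    and "\<And>a b. (a, b) \<in> \<tau> \<Longrightarrow> (b, a) \<in> \<tau>"
    and "\<And>a b c. \<lbrakk>(a, b) \<in> \<tau>; (b, c) \<in> \<tau>\<rbrakk> \<Longrightarrow> (a, c) \<in> \<tau>"
    and "\<And>a b c. \<lbrakk>(a, b) \<in> \<tau>; c \<in> carrier S\<rbrakk> \<Longrightarrow> (c \<cdot>\<^bsub>S\<^esub> a, c \<cdot>\<^bsub>S\<^esub> b) \<in> \<tau>"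
    and "\<And>a b c. \<lbrakk>(a, b) \<in> \<tau>; c \<in> carrier S\<rbrakk> \<Longrightarrow> (a \<cdot>\<^bsub>S\<^esub> c, b \<cdot>\<^bsub>S\<^esub> c) \<in> \<tau>"
  shows "sg_congruence S \<tau>"
  unfolding sg_congruence_def
proof (intro conjI)
  show "equiv (carrier S) \<tau>"
    by (rule equivI[OF assms(1) refl_onI[OF assms(2)] symI[OF assms(3)] transI[OF assms(4)]])
  show "\<forall>(a, b)\<in>\<tau>. \<forall>c\<in>carrier S. (c \<cdot>\<^bsub>S\<^esub> a, c \<cdot>\<^bsub>S\<^esub> b) \<in> \<tau> \<and> (a \<cdot>\<^bsub>S\<^esub> c, b \<cdot>\<^bsub>S\<^esub> c) \<in> \<tau>"
    by (simp add: assms(5,6) split_beta)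
qed

lemma
  assumes "sg_congruence S \<tau>"
  shows sg_congruence_equiv: "equiv (carrier S) \<tau>"
    and sg_congruence_carrier: "(a, b) \<in> \<tau> \<Longrightarrow> a \<in> carrier S \<and> b \<in> carrier S"
    and sg_congruence_refl: "a \<in> carrier S \<Longrightarrow> (a, a) \<in> \<tau>"
    and sg_congruence_sym: "(a, b) \<in> \<tau> \<Longrightarrow> (b, a) \<in> \<tau>"
    and sg_congruence_trans: "\<lbrakk>(a, b) \<in> \<tau>; (b, c) \<in> \<tau>\<rbrakk> \<Longrightarrow> (a, c) \<in> \<tau>"
    and sg_congruence_left: "\<lbrakk>(a, b) \<in> \<tau>; c \<in> carrier S\<rbrakk> \<Longrightarrow> (c \<cdot>\<^bsub>S\<^esub> a, c \<cdot>\<^bsub>S\<^esub> b) \<in> \<tau>"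
    and sg_congruence_right: "\<lbrakk>(a, b) \<in> \<tau>; c \<in> carrier S\<rbrakk> \<Longrightarrow> (a \<cdot>\<^bsub>S\<^esub> c, b \<cdot>\<^bsub>S\<^esub> c) \<in> \<tau>"
  using assms unfolding sg_congruence_def equiv_def refl_on_def sym_def trans_def by blast+

lemma sg_congruence_mult:
  assumes "sg_congruence S \<tau>" "(a, b) \<in> \<tau>" "(c, d) \<in> \<tau>"
  shows "(a \<cdot>\<^bsub>S\<^esub> c, b \<cdot>\<^bsub>S\<^esub> d) \<in> \<tau>"
  using sg_congruence_trans[OF assms(1) sg_congruence_right sg_congruence_left]
    sg_congruence_carrier[OF assms(1)] assms by blast

lemma sg_congruence_Inter:
  assumes "\<C> \<noteq> {}" "\<And>\<tau>. \<tau> \<in> \<C> \<Longrightarrow> sg_congruence S \<tau>"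
  shows "sg_congruence S (\<Inter>\<C>)"
proof (rule sg_congruenceI)
  show "\<Inter>\<C> \<subseteq> carrier S \<times> carrier S" using assms(1) sg_congruence_carrier[OF assms(2)] by (auto simp: ex_in_conv[symmetric])
  note c = assms(2)
  show "(a, a) \<in> \<Inter>\<C>" if "a \<in> carrier S" for a
    using that sg_congruence_refl[OF c] by simp
  show "(b, a) \<in> \<Inter>\<C>" if "(a, b) \<in> \<Inter>\<C>" for a b
    using that sg_congruence_sym[OF c] by simp
  show "(a, d) \<in> \<Inter>\<C>" if "(a, b) \<in> \<Inter>\<C>" "(b, d) \<in> \<Inter>\<C>" for a b d
    using that sg_congruence_trans[OF c] by (meson Inter_iff)
  show "(d \<cdot>\<^bsub>S\<^esub> a, d \<cdot>\<^bsub>S\<^esub> b) \<in> \<Inter>\<C>" if "(a, b) \<in> \<Inter>\<C>" "d \<in> carrier S" for a b d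
    using that sg_congruence_left[OF c] by simp
  show "(a \<cdot>\<^bsub>S\<^esub> d, b \<cdot>\<^bsub>S\<^esub> d) \<in> \<Inter>\<C>" if "(a, b) \<in> \<Inter>\<C>" "d \<in> carrier S" for a b d
    using that sg_congruence_right[OF c] by simp
qed

text \<open>Since \<open>least_congruence\<close> is a definite description, existence must be shown
  before it can be used. The intersection of all candidates is the least one as soon as it is a
  candidate itself.\<close>

lemma is_least_congruence_Inter:
  assumes "sg_congruence S \<tau>" "P \<tau>" "P (\<Inter>{\<tau>. sg_congruence S \<tau> \<and> P \<tau>})"
  shows "is_least_congruence S P (least_congruence S P)"
proof -
  have "is_least_congruence S P (\<Inter>{\<tau>. sg_congruence S \<tau> \<and> P \<tau>})"
    unfolding is_least_congruence_def using assms by (auto intro!: sg_congruence_Inter)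
  then show ?thesis using least_congruence_eqI by metis
qed

lemma is_least_congruence_cong:
  assumes "\<And>\<tau>. sg_congruence S \<tau> \<Longrightarrow> P \<tau> \<longleftrightarrow> Q \<tau>"
  shows "is_least_congruence S P = is_least_congruence S Q"
  using assms unfolding is_least_congruence_def by blast

lemma least_congruence_cong:
  assumes "\<And>\<tau>. sg_congruence S \<tau> \<Longrightarrow> P \<tau> \<longleftrightarrow> Q \<tau>"
  shows "least_congruence S P = least_congruence S Q"
  unfolding least_congruence_def by (subst is_least_congruence_cong[of S P Q]) (use assms in auto)

text \<open>Traces commute with intersections of nonempty families, and \<open>\<rho>\<close> itself
  belongs to the family.\<close>

lemma lower_t_is_least:
  assumes "sg_congruence S \<rho>"
  shows "is_least_congruence S (\<lambda>\<tau>. cong_tr S \<tau> = cong_tr S \<rho>) (lower_t S \<rho>)"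
  unfolding lower_t_def
  by (rule is_least_congruence_Inter[OF assms refl]) (use assms in \<open>auto simp: cong_tr_def\<close>)

text \<open>The hypothesis on traces gives \<open>\<rho> \<inter> \<tau>\<close> the trace of
  \<open>\<rho>\<close>, so minimality applies to this intersection.\<close>

lemma lower_t_subset_if_tr_subset:
  assumes "sg_congruence S \<rho>" "sg_congruence S \<tau>" "cong_tr S \<rho> \<subseteq> \<tau>"
  shows "lower_t S \<rho> \<subseteq> \<tau>"
proof -
  have "sg_congruence S (\<Inter>{\<rho>, \<tau>})" using assms by (intro sg_congruence_Inter) auto
  moreover have "cong_tr S (\<Inter>{\<rho>, \<tau>}) = cong_tr S \<rho>" using assms by (auto simp: cong_tr_def)
  ultimately show ?thesis
    using lower_t_is_least[OF assms(1)] unfolding is_least_congruence_def by fastforce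
qed

section \<open>Quotients\<close>

locale creg_quotient = creg +
  fixes \<rho> :: "'a rel"
  assumes cong: "sg_congruence S \<rho>"
begin

abbreviation quot ("T") where "T \<equiv> quotient_sgrp S \<rho>"
abbreviation proj ("\<q>") where "\<q> a \<equiv> \<rho> `` {a}"

lemma quot_carrier: "carrier T = \<q> ` carrier S"
  by (auto simp: quotient_sgrp_def quotient_def)

lemma proj_carrier [simp]: "a \<in> carrier S \<Longrightarrow> \<q> a \<in> carrier T"
  by (simp add: quot_carrier)

lemma proj_eq_iff: "\<lbrakk>a \<in> carrier S; b \<in> carrier S\<rbrakk> \<Longrightarrow> \<q> a = \<q> b \<longleftrightarrow> (a, b) \<in> \<rho>"
  using eq_equiv_class_iff[OF sg_congruence_equiv[OF cong]] .

lemma proj_eqI: "(a, b) \<in> \<rho> \<Longrightarrow> \<q> a = \<q> b"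
  using equiv_class_eq[OF sg_congruence_equiv[OF cong]] .

text \<open>The product in the quotient is a union over all representatives; by compatibility every
  member is the same class, and the index sets are nonempty.\<close>

lemma proj_mult:
  assumes "a \<in> carrier S" "b \<in> carrier S"
  shows "\<q> a \<cdot>\<^bsub>T\<^esub> \<q> b = \<q> (a \<cdot> b)"
proof -
  have "\<q> (x \<cdot> y) = \<q> (a \<cdot> b)" if "x \<in> \<q> a" "y \<in> \<q> b" for x y
    using that sg_congruence_mult[OF cong, of a x b y] by (simp add: proj_eqI)
  then have "(\<Union>x\<in>\<q> a. \<Union>y\<in>\<q> b. \<q> (x \<cdot> y)) = (\<Union>x\<in>\<q> a. \<Union>y\<in>\<q> b. \<q> (a \<cdot> b))"
    by (intro SUP_cong refl)
  moreover have "\<q> a \<noteq> {}" "\<q> b \<noteq> {}"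
    using assms sg_congruence_refl[OF cong] by blast+
  ultimately show ?thesis unfolding quotient_sgrp_def by simp
qed

lemma quot_completely_regular: "completely_regular T"
proof (rule completely_regularI)
  show "sgrp T" by unfold_locales (auto simp: quot_carrier proj_mult nonempty)
  show "\<exists>x\<in>carrier T. a \<cdot>\<^bsub>T\<^esub> (x \<cdot>\<^bsub>T\<^esub> a) = a \<and> a \<cdot>\<^bsub>T\<^esub> x = x \<cdot>\<^bsub>T\<^esub> a" if a: "a \<in> carrier T" for a
  proof -
    obtain b where "b \<in> carrier S" "a = \<q> b" using a by (auto simp: quot_carrier)
    then show ?thesis by (intro bexI[of _ "\<q> (\<iota> b)"]) (simp_all add: proj_mult)
  qed
qed

sublocale T: creg T
  by unfold_locales (rule quot_completely_regular)

text \<open>The class of \<open>\<iota> a\<close> is a commuting inner inverse of the class of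
  \<open>a\<close>.\<close>

lemma proj_id: "a \<in> carrier S \<Longrightarrow> grp_id T (\<q> a) = \<q> (\<epsilon> a)"
  by (subst T.id_eqI[where x = "\<q> (\<iota> a)"]) (simp_all add: proj_mult)

text \<open>If \<open>a\<close> is related to an idempotent \<open>e\<close>, then
  \<open>\<epsilon> a\<close> is related to \<open>\<epsilon> e = e\<close>. So the existential
  witness can always be \<open>\<epsilon> a\<close>, whatever the congruence.\<close>

lemma cong_ker_iff: "a \<in> cong_ker S \<rho> \<longleftrightarrow> a \<in> carrier S \<and> (a, \<epsilon> a) \<in> \<rho>"
proof
  assume "a \<in> cong_ker S \<rho>"
  then obtain e where a: "a \<in> carrier S" and e: "e \<in> carrier S" "\<epsilon> e = e" "(a, e) \<in> \<rho>"
    by (auto simp: cong_ker_def idempotents_iff)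
  then have "\<q> a = \<q> e" by (simp add: proj_eqI)
  then have "\<q> (\<epsilon> a) = \<q> a" using a e proj_id by metis
  then show "a \<in> carrier S \<and> (a, \<epsilon> a) \<in> \<rho>" using a proj_eq_iff by (metis id_carrier)
qed (auto simp: cong_ker_def)

text \<open>An explicit form of Lallement's lemma: an idempotent class contains the idempotent
  \<open>\<epsilon> a\<close>.\<close>

lemma proj_idempotent_iff: "a \<in> carrier S \<Longrightarrow> \<q> a \<in> idempotents T \<longleftrightarrow> a \<in> cong_ker S \<rho>"
  unfolding T.idempotents_iff cong_ker_iff
  using sg_congruence_sym[OF cong, of a "\<epsilon> a"] sg_congruence_sym[OF cong, of "\<epsilon> a" a]
  by (auto simp: proj_id proj_eq_iff)

text \<open>Modulo \<open>\<gamma>\<close> all idempotents become the identity of a group. If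
  \<open>e\<close> and \<open>e \<cdot> a\<close> lie over that identity, so does \<open>a\<close>;
  hence the kernel of \<open>\<gamma>\<close> is unitary, and the quotient by \<open>\<rho>\<close>
  sees only this kernel.\<close>

lemma E_unitary_quotI:
  assumes \<gamma>: "sg_congruence S \<gamma>" "idempotents S \<times> idempotents S \<subseteq> \<gamma>"
    and ker: "cong_ker S \<rho> = cong_ker S \<gamma>"
  shows "E_unitary T"
proof -
  have "a \<in> cong_ker S \<gamma>" if ea: "e \<in> cong_ker S \<gamma>" "a \<in> carrier S" "e \<cdot> a \<in> cong_ker S \<gamma>" for e a
  proof -
    obtain f where f: "e \<in> carrier S" "f \<in> idempotents S" "(e, f) \<in> \<gamma>"
      using ea(1) by (auto simp: cong_ker_def)
    obtain g where g: "g \<in> idempotents S" "(e \<cdot> a, g) \<in> \<gamma>"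
      using ea(3) by (auto simp: cong_ker_def)
    have "(\<epsilon> a, f) \<in> \<gamma>" using f ea \<gamma>(2) by auto
    then have "(\<epsilon> a \<cdot> a, e \<cdot> a) \<in> \<gamma>"
      using f ea sg_congruence_right sg_congruence_trans sg_congruence_sym \<gamma>(1) by metis
    then have "(a, g) \<in> \<gamma>" using g ea sg_congruence_trans[OF \<gamma>(1)] by simp
    then show ?thesis using ea g by (auto simp: cong_ker_def)
  qed
  note ker_unitary = this
  have "A \<in> idempotents T" if A: "e \<in> idempotents T" "A \<in> carrier T" "e \<cdot>\<^bsub>T\<^esub> A \<in> idempotents T" for e A
  proof -
    obtain a where a: "a \<in> carrier S" "A = \<q> a" using A(2) by (auto simp: quot_carrier)
    obtain f where f: "f \<in> carrier S" "e = \<q> f"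
      using T.idempotent_carrier[OF A(1)] by (auto simp: quot_carrier)
    have "f \<in> cong_ker S \<rho>" "f \<cdot> a \<in> cong_ker S \<rho>"
      using A a f by (simp_all add: proj_mult proj_idempotent_iff)
    then show ?thesis using ker_unitary[of f a] a ker by (simp add: proj_idempotent_iff)
  qed
  then show ?thesis unfolding E_unitary_def using T.regular by blast
qed

section \<open>Transport of congruences between a semigroup and its quotient\<close>

definition pullback :: "'a set rel \<Rightarrow> 'a rel" where
  "pullback \<gamma> = {(a, b). a \<in> carrier S \<and> b \<in> carrier S \<and> (\<q> a, \<q> b) \<in> \<gamma>}"

lemma pullback_cong:
  assumes "sg_congruence T \<gamma>"
  shows "sg_congruence S (pullback \<gamma>)"
proof -
  note iff = pullback_def
  show ?thesis
  proof (rule sg_congruenceI)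
    show "(a, a) \<in> pullback \<gamma>" if "a \<in> carrier S" for a
      using that sg_congruence_refl[OF assms] by (simp add: iff)
    show "(b, a) \<in> pullback \<gamma>" if "(a, b) \<in> pullback \<gamma>" for a b
      using that sg_congruence_sym[OF assms] by (simp add: iff)
    show "(a, c) \<in> pullback \<gamma>" if "(a, b) \<in> pullback \<gamma>" "(b, c) \<in> pullback \<gamma>" for a b c
      using that sg_congruence_trans[OF assms, of "\<q> a" "\<q> b" "\<q> c"] by (simp add: iff)
    show "(c \<cdot> a, c \<cdot> b) \<in> pullback \<gamma>" if "(a, b) \<in> pullback \<gamma>" "c \<in> carrier S" for a b c
      using that sg_congruence_left[OF assms, of "\<q> a" "\<q> b" "\<q> c"] by (simp add: iff proj_mult)
    show "(a \<cdot> c, b \<cdot> c) \<in> pullback \<gamma>" if "(a, b) \<in> pullback \<gamma>" "c \<in> carrier S" for a b c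
      using that sg_congruence_right[OF assms, of "\<q> a" "\<q> b" "\<q> c"] by (simp add: iff proj_mult)
  qed (auto simp: iff)
qed

lemma pullback_idempotents:
  assumes "idempotents T \<times> idempotents T \<subseteq> \<gamma>"
  shows "idempotents S \<times> idempotents S \<subseteq> pullback \<gamma>"
proof clarify
  fix e f assume "e \<in> idempotents S" "f \<in> idempotents S"
  then have "e \<in> carrier S" "f \<in> carrier S" "\<q> e \<in> idempotents T" "\<q> f \<in> idempotents T"
    by (auto simp: idempotents_iff T.idempotents_iff proj_id)
  then show "(e, f) \<in> pullback \<gamma>" using assms by (auto simp: pullback_def)
qed

lemma cong_ker_pullback:
  assumes "sg_congruence T \<gamma>"
  shows "cong_ker S (pullback \<gamma>) = {a \<in> carrier S. \<q> a \<in> cong_ker T \<gamma>}"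
proof -
  have "creg_quotient S (pullback \<gamma>)"
    by unfold_locales (rule pullback_cong[OF assms])
  moreover have "creg_quotient T \<gamma>"
    by unfold_locales (rule assms)
  ultimately show ?thesis
    by (auto simp: creg_quotient.cong_ker_iff pullback_def proj_id)
qed

definition pushforward :: "'a rel \<Rightarrow> 'a set rel" where
  "pushforward \<delta> = {(\<q> a, \<q> b) | a b. (a, b) \<in> \<delta>}"

text \<open>The inclusion \<open>\<rho> \<subseteq> \<delta>\<close> makes membership independent of
  the representatives, which transitivity and compatibility of the image rely on.\<close>

lemma
  assumes "sg_congruence S \<delta>" "\<rho> \<subseteq> \<delta>"
  shows pushforward_iff: "\<lbrakk>a \<in> carrier S; b \<in> carrier S\<rbrakk> \<Longrightarrow> (\<q> a, \<q> b) \<in> pushforward \<delta> \<longleftrightarrow> (a, b) \<in> \<delta>"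
    and pushforward_cong: "sg_congruence T (pushforward \<delta>)"
proof -
  show iff: "(\<q> a, \<q> b) \<in> pushforward \<delta> \<longleftrightarrow> (a, b) \<in> \<delta>" if "a \<in> carrier S" "b \<in> carrier S" for a b
  proof
    assume "(\<q> a, \<q> b) \<in> pushforward \<delta>"
    then obtain a' b' where "(a', b') \<in> \<delta>" "\<q> a = \<q> a'" "\<q> b = \<q> b'"
      by (auto simp: pushforward_def)
    moreover from this have "(a, a') \<in> \<rho>" "(b, b') \<in> \<rho>"
      using proj_eq_iff that sg_congruence_carrier[OF assms(1), of a' b'] by simp_all
    ultimately show "(a, b) \<in> \<delta>"
      using assms(2) sg_congruence_sym[OF assms(1), of b b']
        sg_congruence_trans[OF assms(1), of a a' b'] sg_congruence_trans[OF assms(1), of a b' b] by blast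
  qed (auto simp: pushforward_def)
  have *: "pushforward \<delta> \<subseteq> carrier T \<times> carrier T"
    using sg_congruence_carrier[OF assms(1)] by (auto simp: pushforward_def quot_carrier)
  have trans: "(A, C) \<in> pushforward \<delta>" if "(A, B) \<in> pushforward \<delta>" "(B, C) \<in> pushforward \<delta>" for A B C
  proof -
    have "A \<in> carrier T" "B \<in> carrier T" "C \<in> carrier T" using that * by auto
    then obtain a b c where "A = \<q> a" "B = \<q> b" "C = \<q> c" "a \<in> carrier S" "b \<in> carrier S" "c \<in> carrier S"
      by (auto simp: quot_carrier)
    then show ?thesis
      using that iff[of a b] iff[of b c] iff[of a c] sg_congruence_trans[OF assms(1), of a b c] by simp
  qed
  note c = sg_congruence_carrier[OF assms(1)]
  show "sg_congruence T (pushforward \<delta>)"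
  proof (rule sg_congruenceI[OF * _ _ trans])
    show "(A, A) \<in> pushforward \<delta>" if "A \<in> carrier T" for A
      using that sg_congruence_refl[OF assms(1)] by (auto simp: pushforward_def quot_carrier)
    show "(B, A) \<in> pushforward \<delta>" if "(A, B) \<in> pushforward \<delta>" for A B
      using that sg_congruence_sym[OF assms(1)] by (auto simp: pushforward_def)
    fix A B C assume "(A, B) \<in> pushforward \<delta>" "C \<in> carrier T"
    then obtain a b d where "A = \<q> a" "B = \<q> b" "C = \<q> d" "(a, b) \<in> \<delta>" "d \<in> carrier S"
      by (auto simp: pushforward_def quot_carrier)
    moreover from this have "a \<in> carrier S" "b \<in> carrier S" using c[of a b] by simp_all
    ultimately show "(C \<cdot>\<^bsub>T\<^esub> A, C \<cdot>\<^bsub>T\<^esub> B) \<in> pushforward \<delta>" "(A \<cdot>\<^bsub>T\<^esub> C, B \<cdot>\<^bsub>T\<^esub> C) \<in> pushforward \<delta>"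
      using sg_congruence_left[OF assms(1)] sg_congruence_right[OF assms(1)]
      by (simp_all add: proj_mult iff)
  qed
qed

end

section \<open>Kernels under intersection, and groups among completely regular semigroups\<close>

context creg
begin

lemma quotientI: "sg_congruence S \<tau> \<Longrightarrow> creg_quotient S \<tau>"
  by unfold_locales

lemma mem_cong_ker_iff:
  "sg_congruence S \<tau> \<Longrightarrow> a \<in> cong_ker S \<tau> \<longleftrightarrow> a \<in> carrier S \<and> (a, \<epsilon> a) \<in> \<tau>"
  by (rule creg_quotient.cong_ker_iff[OF quotientI])

text \<open>The projection preserves identities, so congruences respect the unary operation
  \<epsilon> as well.\<close>

lemma sg_congruence_id:
  assumes "sg_congruence S \<tau>" "(a, b) \<in> \<tau>"
  shows "(\<epsilon> a, \<epsilon> b) \<in> \<tau>"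
proof -
  interpret creg_quotient S \<tau> by (rule quotientI[OF assms(1)])
  have ab: "a \<in> carrier S" "b \<in> carrier S" using sg_congruence_carrier[OF assms] by simp_all
  have "\<tau> `` {\<epsilon> a} = \<tau> `` {\<epsilon> b}" using proj_eqI[OF assms(2)] proj_id[OF ab(1)] proj_id[OF ab(2)] by simp
  then show ?thesis using ab proj_eq_iff by simp
qed

lemma universal_cong: "sg_congruence S (universal_cong S)"
  by (rule sg_congruenceI) (auto simp: universal_cong_def)

text \<open>Membership in a kernel tests the single pair \<open>(a, \<epsilon> a)\<close>, with the
  same witness for every congruence; hence kernels commute with these intersections.\<close>

lemma lower_k_is_least:
  assumes "sg_congruence S \<rho>"
  shows "is_least_congruence S (\<lambda>\<tau>. cong_ker S \<tau> = cong_ker S \<rho>) (lower_k S \<rho>)"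
  unfolding lower_k_def
proof (rule is_least_congruence_Inter[OF assms refl])
  let ?C = "{\<tau>. sg_congruence S \<tau> \<and> cong_ker S \<tau> = cong_ker S \<rho>}"
  have "sg_congruence S (\<Inter>?C)" using assms by (intro sg_congruence_Inter) auto
  then have 1: "a \<in> cong_ker S (\<Inter>?C) \<longleftrightarrow> a \<in> carrier S \<and> (\<forall>\<tau>\<in>?C. (a, \<epsilon> a) \<in> \<tau>)" for a
    by (simp add: mem_cong_ker_iff)
  have 2: "(\<forall>\<tau>\<in>?C. (a, \<epsilon> a) \<in> \<tau>) \<longleftrightarrow> (a, \<epsilon> a) \<in> \<rho>" if "a \<in> carrier S" for a
    using assms that mem_cong_ker_iff[of _ a] by blast
  show "cong_ker S (\<Inter>?C) = cong_ker S \<rho>"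
  proof (rule Set.set_eqI)
    show "a \<in> cong_ker S (\<Inter>?C) \<longleftrightarrow> a \<in> cong_ker S \<rho>" for a
      unfolding 1 mem_cong_ker_iff[OF assms] using 2 by blast
  qed
qed

text \<open>With a single idempotent, all maximal subgroups share one identity, which is then an
  identity of \<open>S\<close>.\<close>

lemma is_group_iff: "is_group S \<longleftrightarrow> (\<forall>e\<in>idempotents S. \<forall>f\<in>idempotents S. e = f)"
proof
  assume "is_group S"
  then obtain u where "group \<lparr>carrier = carrier S, mult = sg_mult S, one = u\<rparr>" (is "group ?G")
    by (auto simp: is_group_def)
  then interpret G: group ?G .
  have "e = u" if "e \<in> idempotents S" for e
    using that G.r_cancel_one'[of e e] by (auto simp: idempotents_def)
  then show "\<forall>e\<in>idempotents S. \<forall>f\<in>idempotents S. e = f" by blast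
next
  assume *: "\<forall>e\<in>idempotents S. \<forall>f\<in>idempotents S. e = f"
  obtain b where b: "b \<in> carrier S" using nonempty by blast
  have id: "\<epsilon> a = \<epsilon> b" if "a \<in> carrier S" for a using * that b by simp
  have "group \<lparr>carrier = carrier S, mult = sg_mult S, one = \<epsilon> b\<rparr>"
  proof (rule groupI; simp add: b)
    show "\<epsilon> b \<cdot> a = a" if "a \<in> carrier S" for a using id_mult[OF that] id[OF that] by simp
    show "\<exists>y\<in>carrier S. y \<cdot> a = \<epsilon> b" if "a \<in> carrier S" for a
      using inv_mult[OF that] id[OF that] inv_carrier[OF that] by metis
  qed
  then show "is_group S" by (auto simp: is_group_def)
qed

end

lemma (in creg_quotient) is_group_quot_iff: "is_group T \<longleftrightarrow> idempotents S \<times> idempotents S \<subseteq> \<rho>"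
proof
  assume *: "is_group T"
  show "idempotents S \<times> idempotents S \<subseteq> \<rho>"
  proof clarify
    fix e f assume "e \<in> idempotents S" "f \<in> idempotents S"
    then have "e \<in> carrier S" "f \<in> carrier S" "\<q> e \<in> idempotents T" "\<q> f \<in> idempotents T"
      by (auto simp: idempotents_iff T.idempotents_iff proj_id)
    then show "(e, f) \<in> \<rho>" using * proj_eq_iff[of e f] unfolding T.is_group_iff by simp
  qed
next
  assume *: "idempotents S \<times> idempotents S \<subseteq> \<rho>"
  have "A = B" if AB: "A \<in> idempotents T" "B \<in> idempotents T" for A B
  proof -
    obtain a where a: "a \<in> carrier S" "A = \<q> a"
      using T.idempotent_carrier[OF AB(1)] by (auto simp: quot_carrier)
    obtain b where b: "b \<in> carrier S" "B = \<q> b"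
      using T.idempotent_carrier[OF AB(2)] by (auto simp: quot_carrier)
    have "A = \<q> (\<epsilon> a)" "B = \<q> (\<epsilon> b)" using AB a b proj_id by (simp_all add: T.idempotents_iff)
    moreover have "(\<epsilon> a, \<epsilon> b) \<in> \<rho>" using * a b by auto
    ultimately show ?thesis by (simp add: proj_eqI)
  qed
  then show "is_group T" by (simp add: T.is_group_iff)
qed

section \<open>The least group congruence\<close>

context creg
begin

abbreviation sigma ("\<sigma>") where "\<sigma> \<equiv> least_group_cong S"

text \<open>Having a group quotient amounts to relating all idempotents, a property that the
  universal congruence has and that survives intersection.\<close>

lemma sigma_is_least: "is_least_congruence S (\<lambda>\<tau>. idempotents S \<times> idempotents S \<subseteq> \<tau>) \<sigma>"
proof -
  have "\<sigma> = least_congruence S (\<lambda>\<tau>. idempotents S \<times> idempotents S \<subseteq> \<tau>)"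
    unfolding least_group_cong_def
    by (rule least_congruence_cong) (rule creg_quotient.is_group_quot_iff[OF quotientI])
  then show ?thesis
    using is_least_congruence_Inter[OF universal_cong, of "\<lambda>\<tau>. idempotents S \<times> idempotents S \<subseteq> \<tau>"]
    by (auto simp: universal_cong_def idempotents_def)
qed

lemma sigma_cong: "sg_congruence S \<sigma>"
  and sigma_idempotents: "\<lbrakk>e \<in> idempotents S; f \<in> idempotents S\<rbrakk> \<Longrightarrow> (e, f) \<in> \<sigma>"
  and sigma_least: "\<lbrakk>sg_congruence S \<tau>; idempotents S \<times> idempotents S \<subseteq> \<tau>\<rbrakk> \<Longrightarrow> \<sigma> \<subseteq> \<tau>"
  using sigma_is_least unfolding is_least_congruence_def by auto

lemma lower_t_universal: "lower_t S (universal_cong S) = \<sigma>"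
proof -
  have "(cong_tr S \<tau> = cong_tr S (universal_cong S)) \<longleftrightarrow> idempotents S \<times> idempotents S \<subseteq> \<tau>" for \<tau>
    by (auto simp: cong_tr_def universal_cong_def idempotents_def)
  then show ?thesis
    unfolding lower_t_def using least_congruence_eqI[OF sigma_is_least] by simp
qed

section \<open>E-unitary congruences\<close>

text \<open>In an \<open>E\<close>-unitary completely regular semigroup the pairs with \<open>a b\<^sup>-\<^sup>1\<close> idempotent form a
  group congruence whose kernel is just \<open>E(S)\<close>; \<open>idempotent_swap\<close> allows cyclic rotation of
  products that are idempotent.\<close>

lemma E_unitary_group_cong:
  assumes "E_unitary S"
  obtains \<gamma> where "sg_congruence S \<gamma>" "idempotents S \<times> idempotents S \<subseteq> \<gamma>" "cong_ker S \<gamma> = idempotents S"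
proof -
  let ?E = "idempotents S"
  note car = idempotent_carrier
  have unitL: "a \<in> ?E" if "e \<in> ?E" "a \<in> carrier S" "e \<cdot> a \<in> ?E" for e a
    using assms that unfolding E_unitary_def by blast
  have unitR: "a \<in> ?E" if "e \<in> ?E" "a \<in> carrier S" "a \<cdot> e \<in> ?E" for e a
    using unitL[OF that(1,2)] idempotent_swap[OF that(2) car[OF that(1)] that(3)] by simp
  \<comment> \<open>For the inverse \<open>x\<close> of \<open>e f\<close>, the relation
    \<open>x e f x = x\<close> makes \<open>f x e\<close> idempotent. Unitarity strips
    \<open>f\<close> and \<open>e\<close>, so \<open>x\<close> is idempotent, and hence so is
    \<open>e f\<close>.\<close>
  have mult: "e \<cdot> f \<in> ?E" if "e \<in> ?E" "f \<in> ?E" for e f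
  proof -
    have c: "e \<in> carrier S" "f \<in> carrier S" using car that by auto
    define p where "p = e \<cdot> f"
    define x where "x = \<iota> p"
    have p: "p \<in> carrier S" and x: "x \<in> carrier S" using c by (simp_all add: x_def p_def)
    have "x \<cdot> (p \<cdot> x) = x" unfolding x_def by (rule inv_mult_inv[OF p])
    then have "x \<cdot> (e \<cdot> (f \<cdot> x)) = x" using c x by (simp add: p_def)
    from arg_cong[OF this, of "\<lambda>z. f \<cdot> (z \<cdot> e)"] have "f \<cdot> (x \<cdot> e) \<in> ?E"
      using c x by (simp add: idempotents_def)
    from unitL[OF that(2) _ this] have "x \<cdot> e \<in> ?E" using c x by simp
    from unitR[OF that(1) x this] have "x \<cdot> x = x" by (simp add: idempotents_def)
    from arg_cong[OF this, of "\<lambda>z. p \<cdot> (p \<cdot> z)"] have "\<epsilon> p = p"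
      using p by (simp add: x_def)
    then show ?thesis using p id_idempotent[OF p] by (simp add: p_def)
  qed
  define \<gamma> where "\<gamma> = {(a, b). a \<in> carrier S \<and> b \<in> carrier S \<and> a \<cdot> \<iota> b \<in> ?E}"
  have cong: "sg_congruence S \<gamma>"
  proof (rule sg_congruenceI)
    show "\<gamma> \<subseteq> carrier S \<times> carrier S" by (auto simp: \<gamma>_def)
    show "(a, a) \<in> \<gamma>" if "a \<in> carrier S" for a using that by (simp add: \<gamma>_def)
    show "(b, a) \<in> \<gamma>" if "(a, b) \<in> \<gamma>" for a b
    proof -
      have ab: "a \<in> carrier S" "b \<in> carrier S" "a \<cdot> \<iota> b \<in> ?E" using that by (auto simp: \<gamma>_def)
      \<comment> \<open>Rotating the idempotent \<open>\<epsilon> a \<cdot> \<epsilon> b\<close>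
        produces \<open>(a \<cdot> \<iota> b) \<cdot> (b \<cdot> \<iota> a)\<close>, whose left
        factor is then stripped.\<close>
      have "\<iota> a \<cdot> (a \<cdot> \<epsilon> b) \<in> ?E" using mult[of "\<epsilon> a" "\<epsilon> b"] ab by simp
      then have "(a \<cdot> \<epsilon> b) \<cdot> \<iota> a \<in> ?E" using ab by - (rule idempotent_swap, simp_all)
      then have "(a \<cdot> \<iota> b) \<cdot> (b \<cdot> \<iota> a) \<in> ?E" using ab by simp
      then show ?thesis using unitL[OF ab(3), of "b \<cdot> \<iota> a"] ab by (simp add: \<gamma>_def)
    qed
    show "(a, c) \<in> \<gamma>" if "(a, b) \<in> \<gamma>" "(b, c) \<in> \<gamma>" for a b c
    proof -
      have ab: "a \<in> carrier S" "b \<in> carrier S" "c \<in> carrier S" "a \<cdot> \<iota> b \<in> ?E" "b \<cdot> \<iota> c \<in> ?E"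
        using that by (auto simp: \<gamma>_def)
      \<comment> \<open>The product of the two given idempotents has \<open>\<epsilon> b\<close> in
        the middle; rotation moves it to the end, where unitarity removes it.\<close>
      have "(a \<cdot> \<epsilon> b) \<cdot> \<iota> c \<in> ?E" using mult[OF ab(4,5)] ab by simp
      then have "\<iota> c \<cdot> (a \<cdot> \<epsilon> b) \<in> ?E" using ab by - (rule idempotent_swap, simp_all)
      then have "\<iota> c \<cdot> a \<in> ?E" using ab by - (rule unitR[of "\<epsilon> b"], simp_all)
      then have "a \<cdot> \<iota> c \<in> ?E" using ab by - (rule idempotent_swap[of "\<iota> c"], simp_all)
      then show ?thesis using ab by (simp add: \<gamma>_def)
    qed
    show "(c \<cdot> a, c \<cdot> b) \<in> \<gamma>" if "(a, b) \<in> \<gamma>" "c \<in> carrier S" for a b c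
    proof -
      have ab: "a \<in> carrier S" "b \<in> carrier S" "c \<in> carrier S" "a \<cdot> \<iota> b \<in> ?E"
        using that by (auto simp: \<gamma>_def)
      \<comment> \<open>The inverse of a product has no simple formula, so it stays opaque. The
        idempotents \<open>p c b\<close> and \<open>\<iota> b \<cdot> a\<close> are multiplied, and
        the resulting \<open>\<epsilon> b\<close> is rotated to the end and stripped.\<close>
      define p where "p = \<iota> (c \<cdot> b)"
      have p: "p \<in> carrier S" "p \<cdot> (c \<cdot> b) \<in> ?E"
        using ab inv_mult[of "c \<cdot> b"] by (simp_all add: p_def)
      have "\<iota> b \<cdot> a \<in> ?E" using ab by - (rule idempotent_swap[of a], simp_all)
      then have "(p \<cdot> (c \<cdot> b)) \<cdot> (\<iota> b \<cdot> a) \<in> ?E" using p(2) mult by blast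
      then have "(p \<cdot> (c \<cdot> \<epsilon> b)) \<cdot> a \<in> ?E" using ab p by simp
      then have "a \<cdot> (p \<cdot> (c \<cdot> \<epsilon> b)) \<in> ?E" using ab p by - (rule idempotent_swap, simp_all)
      then have "a \<cdot> (p \<cdot> c) \<in> ?E" using ab p by - (rule unitR[of "\<epsilon> b"], simp_all)
      then have "c \<cdot> (a \<cdot> p) \<in> ?E" using ab p by - (rule idempotent_swap[of "a \<cdot> p"], simp_all)
      then show ?thesis using ab by (simp add: \<gamma>_def p_def)
    qed
    show "(a \<cdot> c, b \<cdot> c) \<in> \<gamma>" if "(a, b) \<in> \<gamma>" "c \<in> carrier S" for a b c
    proof -
      have ab: "a \<in> carrier S" "b \<in> carrier S" "c \<in> carrier S" "a \<cdot> \<iota> b \<in> ?E"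
        using that by (auto simp: \<gamma>_def)
      define p where "p = \<iota> (b \<cdot> c)"
      have p: "p \<in> carrier S" "(b \<cdot> c) \<cdot> p \<in> ?E"
        using ab mult_inv[of "b \<cdot> c"] by (simp_all add: p_def del: assoc)
      have "(a \<cdot> \<iota> b) \<cdot> ((b \<cdot> c) \<cdot> p) \<in> ?E" using ab p(2) mult by blast
      then have "a \<cdot> (\<epsilon> b \<cdot> (c \<cdot> p)) \<in> ?E" using ab p by simp
      then have "(\<epsilon> b \<cdot> (c \<cdot> p)) \<cdot> a \<in> ?E" using ab p by - (rule idempotent_swap[of a], simp_all)
      then have "(c \<cdot> p) \<cdot> a \<in> ?E" using ab p by - (rule unitL[of "\<epsilon> b"], simp_all)
      then have "a \<cdot> (c \<cdot> p) \<in> ?E" using ab p by - (rule idempotent_swap[of "c \<cdot> p"], simp_all)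
      then show ?thesis using ab by (simp add: \<gamma>_def p_def)
    qed
  qed
  have inv_E: "\<iota> e = e" if "e \<in> ?E" for e
    using that id_inv[of e] mult_inv[of e] by (simp add: idempotents_iff)
  have "?E \<times> ?E \<subseteq> \<gamma>" using car mult inv_E by (auto simp: \<gamma>_def)
  moreover have "a \<in> cong_ker S \<gamma> \<longleftrightarrow> a \<in> ?E" for a
    unfolding mem_cong_ker_iff[OF cong] using car mult_id[of a] inv_E[of "\<epsilon> a"]
    by (auto simp: \<gamma>_def)
  ultimately show ?thesis using that cong by blast
qed

text \<open>If \<open>S/\<tau>\<close> is \<open>E\<close>-unitary then \<open>ker \<sigma> \<subseteq> ker \<tau>\<close>, so \<open>\<sigma> \<inter> \<tau>\<close> has the same kernel as \<open>\<sigma>\<close>.\<close>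

lemma lower_k_sigma_is_least_E_unitary:
  "is_least_congruence S (\<lambda>\<tau>. E_unitary (quotient_sgrp S \<tau>)) (lower_k S \<sigma>)"
proof -
  have k: "sg_congruence S (lower_k S \<sigma>)" "cong_ker S (lower_k S \<sigma>) = cong_ker S \<sigma>"
    and least: "\<And>\<tau>. \<lbrakk>sg_congruence S \<tau>; cong_ker S \<tau> = cong_ker S \<sigma>\<rbrakk> \<Longrightarrow> lower_k S \<sigma> \<subseteq> \<tau>"
    using lower_k_is_least[OF sigma_cong] unfolding is_least_congruence_def by auto
  have "E_unitary (quotient_sgrp S (lower_k S \<sigma>))"
    using creg_quotient.E_unitary_quotI[OF quotientI[OF k(1)] sigma_cong _ k(2)] sigma_idempotents
    by auto
  moreover have "lower_k S \<sigma> \<subseteq> \<tau>" if \<tau>: "sg_congruence S \<tau>" "E_unitary (quotient_sgrp S \<tau>)" for \<tau>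
  proof -
    interpret creg_quotient S \<tau> by (rule quotientI[OF \<tau>(1)])
    let ?T = "quotient_sgrp S \<tau>"
    \<comment> \<open>As \<open>\<gamma>\<close> has only idempotents in its kernel, its preimage in
      \<open>S\<close> has the kernel of \<open>\<tau>\<close>. That preimage relates all
      idempotents, so it contains \<sigma>.\<close>
    obtain \<gamma> where \<gamma>: "sg_congruence ?T \<gamma>" "idempotents ?T \<times> idempotents ?T \<subseteq> \<gamma>" "cong_ker ?T \<gamma> = idempotents ?T"
      using T.E_unitary_group_cong[OF \<tau>(2)] .
    have "cong_ker S \<sigma> \<subseteq> cong_ker S (pullback \<gamma>)" if "\<sigma> \<subseteq> pullback \<gamma>"
      using that by (auto simp: cong_ker_def)
    moreover have "\<sigma> \<subseteq> pullback \<gamma>"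
      by (rule sigma_least[OF pullback_cong pullback_idempotents]) (fact \<gamma>)+
    moreover have "cong_ker S (pullback \<gamma>) = cong_ker S \<tau>"
      unfolding cong_ker_pullback[OF \<gamma>(1)] \<gamma>(3) using proj_idempotent_iff by (auto simp: cong_ker_iff)
    ultimately have sub: "cong_ker S \<sigma> \<subseteq> cong_ker S \<tau>" by simp
    have c: "sg_congruence S (\<Inter>{\<sigma>, \<tau>})"
      using \<tau>(1) sigma_cong by (intro sg_congruence_Inter) auto
    have "a \<in> cong_ker S (\<Inter>{\<sigma>, \<tau>}) \<longleftrightarrow> a \<in> cong_ker S \<sigma>" for a
      using sub mem_cong_ker_iff[OF c, of a] mem_cong_ker_iff[OF \<tau>(1), of a] mem_cong_ker_iff[OF sigma_cong, of a]
      by auto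
    then have "lower_k S \<sigma> \<subseteq> \<Inter>{\<sigma>, \<tau>}" using least[OF c] by blast
    then show ?thesis by blast
  qed
  ultimately show ?thesis unfolding is_least_congruence_def using k(1) by blast
qed

lemma least_E_unitary_cong: "least_E_unitary_cong S = lower_k S \<sigma>"
  unfolding least_E_unitary_cong_def by (rule least_congruence_eqI[OF lower_k_sigma_is_least_E_unitary])

end

section \<open>The kernel of the least group congruence\<close>

context creg
begin

abbreviation ker_carrier ("K") where "K \<equiv> cong_ker S \<sigma>"

lemma mem_ker_iff: "a \<in> K \<longleftrightarrow> a \<in> carrier S \<and> (a, \<epsilon> a) \<in> \<sigma>"
  by (rule mem_cong_ker_iff[OF sigma_cong])

lemma ker_carrier: "a \<in> K \<Longrightarrow> a \<in> carrier S"
  by (simp add: mem_ker_iff)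

lemma ker_if_sigma_idempotent: "\<lbrakk>(a, e) \<in> \<sigma>; e \<in> idempotents S\<rbrakk> \<Longrightarrow> a \<in> K"
  using sg_congruence_carrier[OF sigma_cong, of a e] by (auto simp: cong_ker_def)

lemma idempotent_ker: "e \<in> idempotents S \<Longrightarrow> e \<in> K"
  by (rule ker_if_sigma_idempotent[OF sigma_idempotents])

lemma ker_mult:
  assumes "a \<in> K" "b \<in> K"
  shows "a \<cdot> b \<in> K"
proof (rule ker_if_sigma_idempotent)
  have c: "a \<in> carrier S" "b \<in> carrier S" using assms ker_carrier by simp_all
  have "(b, \<epsilon> a) \<in> \<sigma>"
    by (rule sg_congruence_trans[OF sigma_cong _ sigma_idempotents[of "\<epsilon> b"]])
      (use assms c in \<open>simp_all add: mem_ker_iff\<close>)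
  then show "(a \<cdot> b, \<epsilon> a \<cdot> \<epsilon> a) \<in> \<sigma>"
    using assms sg_congruence_mult[OF sigma_cong, of a "\<epsilon> a" b "\<epsilon> a"] by (simp add: mem_ker_iff)
  show "\<epsilon> a \<cdot> \<epsilon> a \<in> idempotents S" using c by simp
qed

lemma ker_inv:
  assumes "a \<in> K"
  shows "\<iota> a \<in> K"
proof (rule ker_if_sigma_idempotent)
  have c: "a \<in> carrier S" "(\<epsilon> a, a) \<in> \<sigma>"
    using assms sg_congruence_sym[OF sigma_cong] by (simp_all add: mem_ker_iff)
  then show "(\<iota> a, \<epsilon> a) \<in> \<sigma>" using sg_congruence_left[OF sigma_cong c(2), of "\<iota> a"] by simp
  show "\<epsilon> a \<in> idempotents S" using c by simp
qed

lemma ker_sigma_eq: "ker_sigma S = restrict_to S K"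
  by (simp add: ker_sigma_def)

lemma ker_sigma_completely_regular: "completely_regular (ker_sigma S)"
proof (rule completely_regularI)
  obtain b where "b \<in> carrier S" using nonempty by blast
  then have "\<epsilon> b \<in> K" by (simp add: idempotent_ker)
  then have "K \<noteq> {}" by blast
  then show "sgrp (ker_sigma S)"
    by unfold_locales (simp_all add: ker_sigma_eq ker_mult ker_carrier)
  show "\<exists>x\<in>carrier (ker_sigma S). a \<cdot>\<^bsub>ker_sigma S\<^esub> (x \<cdot>\<^bsub>ker_sigma S\<^esub> a) = a \<and>
      a \<cdot>\<^bsub>ker_sigma S\<^esub> x = x \<cdot>\<^bsub>ker_sigma S\<^esub> a" if "a \<in> carrier (ker_sigma S)" for a
    using that by (intro bexI[of _ "\<iota> a"]) (simp_all add: ker_sigma_eq ker_inv ker_carrier)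
qed

text \<open>As \<open>K\<close> is closed under \<iota>, \<open>\<iota> a\<close> is a commuting
  inner inverse inside \<open>K\<close> too. Hence \<H> of \<open>ker_sigma S\<close> is the
  restriction of \<H> of \<open>S\<close>.\<close>

lemma ker_sigma_id:
  assumes "a \<in> K"
  shows "grp_id (ker_sigma S) a = \<epsilon> a"
proof -
  interpret K: creg "ker_sigma S"
    by unfold_locales (rule ker_sigma_completely_regular)
  show ?thesis
    by (subst K.id_eqI[where x = "\<iota> a"]) (use assms in \<open>simp_all add: ker_sigma_eq ker_inv ker_carrier\<close>)
qed

lemma green_H_ker_sigma_iff: "(a, b) \<in> green_H (ker_sigma S) \<longleftrightarrow> a \<in> K \<and> b \<in> K \<and> \<epsilon> a = \<epsilon> b"
proof -
  have "creg (ker_sigma S)"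
    by unfold_locales (rule ker_sigma_completely_regular)
  from creg.green_H_iff[OF this, of a b] show ?thesis
    using ker_sigma_id[of a] ker_sigma_id[of b] by (auto simp: ker_sigma_eq)
qed

text \<open>Expresses the condition through the operations of \<open>S\<close> alone, so that the
  subsemigroup can be left behind.\<close>

lemma cryptogroup_ker_sigma_iff:
  "cryptogroup (ker_sigma S) \<longleftrightarrow>
    (\<forall>a\<in>K. \<forall>b\<in>K. \<forall>c\<in>K. \<epsilon> a = \<epsilon> b \<longrightarrow> \<epsilon> (c \<cdot> a) = \<epsilon> (c \<cdot> b) \<and> \<epsilon> (a \<cdot> c) = \<epsilon> (b \<cdot> c))"
proof -
  have K: "carrier (ker_sigma S) = K" "sg_mult (ker_sigma S) = sg_mult S"
    by (simp_all add: ker_sigma_eq)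
  show ?thesis
  proof
    assume "cryptogroup (ker_sigma S)"
    then have H: "sg_congruence (ker_sigma S) (green_H (ker_sigma S))"
      by (simp add: cryptogroup_def)
    show "\<forall>a\<in>K. \<forall>b\<in>K. \<forall>c\<in>K. \<epsilon> a = \<epsilon> b \<longrightarrow> \<epsilon> (c \<cdot> a) = \<epsilon> (c \<cdot> b) \<and> \<epsilon> (a \<cdot> c) = \<epsilon> (b \<cdot> c)"
    proof (intro ballI impI)
      fix a b c assume abc: "a \<in> K" "b \<in> K" "c \<in> K" "\<epsilon> a = \<epsilon> b"
      then have "(a, b) \<in> green_H (ker_sigma S)" by (simp add: green_H_ker_sigma_iff)
      from sg_congruence_left[OF H this, of c] sg_congruence_right[OF H this, of c]
      show "\<epsilon> (c \<cdot> a) = \<epsilon> (c \<cdot> b) \<and> \<epsilon> (a \<cdot> c) = \<epsilon> (b \<cdot> c)"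
        using abc(3) by (simp add: K green_H_ker_sigma_iff)
    qed
  next
    assume *: "\<forall>a\<in>K. \<forall>b\<in>K. \<forall>c\<in>K. \<epsilon> a = \<epsilon> b \<longrightarrow> \<epsilon> (c \<cdot> a) = \<epsilon> (c \<cdot> b) \<and> \<epsilon> (a \<cdot> c) = \<epsilon> (b \<cdot> c)"
    have "sg_congruence (ker_sigma S) (green_H (ker_sigma S))"
    proof (rule sg_congruenceI)
      show "green_H (ker_sigma S) \<subseteq> carrier (ker_sigma S) \<times> carrier (ker_sigma S)"
        by (auto simp: green_H_ker_sigma_iff K)
      fix a b c assume "(a, b) \<in> green_H (ker_sigma S)" "c \<in> carrier (ker_sigma S)"
      then have abc: "a \<in> K" "b \<in> K" "c \<in> K" "\<epsilon> a = \<epsilon> b"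
        by (simp_all add: green_H_ker_sigma_iff K)
      then have "\<epsilon> (c \<cdot> a) = \<epsilon> (c \<cdot> b) \<and> \<epsilon> (a \<cdot> c) = \<epsilon> (b \<cdot> c)" using * by blast
      then show "(c \<cdot>\<^bsub>ker_sigma S\<^esub> a, c \<cdot>\<^bsub>ker_sigma S\<^esub> b) \<in> green_H (ker_sigma S)"
        "(a \<cdot>\<^bsub>ker_sigma S\<^esub> c, b \<cdot>\<^bsub>ker_sigma S\<^esub> c) \<in> green_H (ker_sigma S)"
        using abc by (simp_all add: green_H_ker_sigma_iff K ker_mult)
    qed (simp_all add: green_H_ker_sigma_iff K)
    then show "cryptogroup (ker_sigma S)"
      by (simp add: cryptogroup_def ker_sigma_completely_regular)
  qed
qed

text \<open>If \<open>K\<close> is a cryptogroup, left multiplication by \<open>k \<in> K\<close> does not change the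
  \<open>\<H>\<close>-class of any \<open>y\<close> in \<open>S\<close>, not just in \<open>K\<close>, with \<open>k\<^sup>0 y = y\<close>: already \<open>m = k y\<^sup>0\<close> is
  \<open>\<H>\<close>-related to \<open>y\<^sup>0\<close> within \<open>K\<close>.\<close>

lemma id_ker_mult:
  assumes crypt: "cryptogroup (ker_sigma S)" and k: "k \<in> K" and y: "y \<in> carrier S"
  shows "\<epsilon> k \<cdot> y = y \<Longrightarrow> \<epsilon> (k \<cdot> y) = \<epsilon> y" "y \<cdot> \<epsilon> k = y \<Longrightarrow> \<epsilon> (y \<cdot> k) = \<epsilon> y"
proof -
  have kc: "k \<in> carrier S" using k by (rule ker_carrier)
  have idid: "\<epsilon> (\<epsilon> z) = \<epsilon> z" if "z \<in> carrier S" for z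
    using that id_idempotent idempotents_iff by blast
  have "\<epsilon> k \<in> K" "\<epsilon> y \<in> K" using kc y by (simp_all add: idempotent_ker)
  moreover have "\<epsilon> (c \<cdot> a) = \<epsilon> (c \<cdot> b) \<and> \<epsilon> (a \<cdot> c) = \<epsilon> (b \<cdot> c)"
    if "a \<in> K" "b \<in> K" "c \<in> K" "\<epsilon> a = \<epsilon> b" for a b c
    using crypt that unfolding cryptogroup_ker_sigma_iff by blast
  \<comment> \<open>The elements \<open>k\<close> and \<open>\<epsilon> k\<close> are \<H>-related
    in \<open>K\<close>; both are multiplied by \<open>\<epsilon> y\<close>.\<close>
  ultimately have cr: "\<epsilon> (k \<cdot> \<epsilon> y) = \<epsilon> (\<epsilon> k \<cdot> \<epsilon> y)" "\<epsilon> (\<epsilon> y \<cdot> k) = \<epsilon> (\<epsilon> y \<cdot> \<epsilon> k)"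
    using k idid[OF kc, symmetric] by blast+
  show "\<epsilon> (k \<cdot> y) = \<epsilon> y" if ky: "\<epsilon> k \<cdot> y = y"
  proof -
    define m where "m = k \<cdot> \<epsilon> y"
    have m: "m \<in> carrier S" using kc y by (simp add: m_def)
    have "\<epsilon> k \<cdot> \<epsilon> y = \<epsilon> y" using arg_cong[OF ky, of "\<lambda>z. z \<cdot> \<iota> y"] kc y by simp
    then have em: "\<epsilon> m = \<epsilon> y" using cr idid[OF y] by (simp add: m_def)
    have my: "m \<cdot> y = k \<cdot> y" using kc y by (simp add: m_def)
    \<comment> \<open>Since \<open>m\<close> has identity \<open>\<epsilon> y\<close>,
      \<open>k \<cdot> y\<close> is a right multiple of \<open>y\<close>.\<close>
    have "\<epsilon> y \<cdot> (m \<cdot> y) = m \<cdot> y" using m y by (simp flip: em)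
    then have *: "k \<cdot> y = y \<cdot> (\<iota> y \<cdot> (k \<cdot> y))" using my kc y by simp
    \<comment> \<open>Conversely, \<open>k \<cdot> y \<cdot> \<iota> y\<close> is \<open>m\<close>,
      so a factor containing \<open>\<iota> m\<close> recovers \<open>y\<close> from
      \<open>k \<cdot> y\<close>.\<close>
    have "(k \<cdot> y) \<cdot> (\<iota> y \<cdot> (\<iota> m \<cdot> y)) = (k \<cdot> \<epsilon> y) \<cdot> (\<iota> m \<cdot> y)" using kc y m by simp
    also have "\<dots> = m \<cdot> (\<iota> m \<cdot> y)" by (simp only: m_def)
    also have "\<dots> = y" using m y em by simp
    finally have **: "y = (k \<cdot> y) \<cdot> (\<iota> y \<cdot> (\<iota> m \<cdot> y))" by simp
    have "y = \<iota> k \<cdot> (k \<cdot> y)" using kc y ky by simp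
    then show ?thesis
      by (rule id_eq_if_factor[OF _ _ _ _ _ _ refl _ * **, rotated 6]) (use kc y m in simp_all)
  qed
  \<comment> \<open>The left-right dual of the preceding argument.\<close>
  show "\<epsilon> (y \<cdot> k) = \<epsilon> y" if yk: "y \<cdot> \<epsilon> k = y"
  proof -
    define m where "m = \<epsilon> y \<cdot> k"
    have m: "m \<in> carrier S" using kc y by (simp add: m_def)
    have "\<epsilon> y \<cdot> \<epsilon> k = \<epsilon> y" using arg_cong[OF yk, of "\<lambda>z. \<iota> y \<cdot> z"] kc y by simp
    then have em: "\<epsilon> m = \<epsilon> y" using cr idid[OF y] by (simp add: m_def)
    have ym: "y \<cdot> m = y \<cdot> k" using kc y by (simp add: m_def)
    have "(y \<cdot> m) \<cdot> \<epsilon> y = y \<cdot> m" using m y by (simp flip: em)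
    then have *: "y \<cdot> k = (y \<cdot> k \<cdot> \<iota> y) \<cdot> y" using ym kc y by simp
    have "(y \<cdot> \<iota> m \<cdot> \<iota> y) \<cdot> (y \<cdot> k) = (y \<cdot> \<iota> m) \<cdot> (\<epsilon> y \<cdot> k)" using kc y m by simp
    also have "\<dots> = (y \<cdot> \<iota> m) \<cdot> m" by (simp only: m_def)
    also have "\<dots> = y" using m y em by simp
    finally have **: "y = (y \<cdot> \<iota> m \<cdot> \<iota> y) \<cdot> (y \<cdot> k)" by simp
    have "y = (y \<cdot> k) \<cdot> \<iota> k" using kc y yk by simp
    then show ?thesis
      by (rule id_eq_if_factor[OF _ _ _ _ _ _ * ** refl, rotated 6]) (use kc y m in simp_all)
  qed
qed

text \<open>Since \<open>b\<close> is \<sigma>-related to \<open>a\<close>, the multiplier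
  \<open>b \<cdot> \<iota> a\<close> lies in \<open>K\<close>. It carries \<open>a \<cdot> c\<close>
  to \<open>b \<cdot> c\<close> and, by \<open>id_ker_mult\<close>, preserves the \<H>-class; dually
  on the other side.\<close>

lemma green_H_Int_sigma_cong:
  assumes "cryptogroup (ker_sigma S)"
  shows "sg_congruence S (green_H S \<inter> \<sigma>)"
proof (rule sg_congruenceI)
  show "green_H S \<inter> \<sigma> \<subseteq> carrier S \<times> carrier S" by (auto simp: green_H_iff)
  show "(a, a) \<in> green_H S \<inter> \<sigma>" if "a \<in> carrier S" for a
    using that sg_congruence_refl[OF sigma_cong] by (simp add: green_H_iff)
  show "(b, a) \<in> green_H S \<inter> \<sigma>" if "(a, b) \<in> green_H S \<inter> \<sigma>" for a b
    using that sg_congruence_sym[OF sigma_cong, of a b] by (simp add: green_H_iff)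
  show "(a, c) \<in> green_H S \<inter> \<sigma>" if "(a, b) \<in> green_H S \<inter> \<sigma>" "(b, c) \<in> green_H S \<inter> \<sigma>" for a b c
    using that sg_congruence_trans[OF sigma_cong, of a b c] by (simp add: green_H_iff)
next
  fix a b c assume *: "(a, b) \<in> green_H S \<inter> \<sigma>" and c: "c \<in> carrier S"
  then have ab: "a \<in> carrier S" "b \<in> carrier S" "\<epsilon> b = \<epsilon> a" "(b, a) \<in> \<sigma>"
    using sg_congruence_sym[OF sigma_cong] by (auto simp: green_H_iff)
  have b: "\<epsilon> a \<cdot> b = b" "b \<cdot> \<epsilon> a = b" using ab(2) by (simp_all flip: ab(3))
  have k: "b \<cdot> \<iota> a \<in> K" "\<iota> a \<cdot> b \<in> K"
    using sg_congruence_left[OF sigma_cong ab(4), of "\<iota> a"]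
      sg_congruence_right[OF sigma_cong ab(4), of "\<iota> a"] ab(1)
      ker_if_sigma_idempotent[of _ "\<epsilon> a"] by simp_all
  have "\<epsilon> ((b \<cdot> \<iota> a) \<cdot> (a \<cdot> c)) = \<epsilon> (a \<cdot> c)" "\<epsilon> ((c \<cdot> a) \<cdot> (\<iota> a \<cdot> b)) = \<epsilon> (c \<cdot> a)"
    using id_ker_mult(1)[OF assms k(1), of "a \<cdot> c"] id_ker_mult(2)[OF assms k(2), of "c \<cdot> a"]
      ab c id_mult_inv[OF ab(2,1,3)] by simp_all
  moreover have "(b \<cdot> \<epsilon> a) \<cdot> c = b \<cdot> c" by (simp only: b)
  then have "(b \<cdot> \<iota> a) \<cdot> (a \<cdot> c) = b \<cdot> c" using ab c by simp
  moreover have "(c \<cdot> a) \<cdot> (\<iota> a \<cdot> b) = c \<cdot> b" using ab c b by simp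
  ultimately have "\<epsilon> (a \<cdot> c) = \<epsilon> (b \<cdot> c)" "\<epsilon> (c \<cdot> a) = \<epsilon> (c \<cdot> b)" by simp_all
  then show "(c \<cdot> a, c \<cdot> b) \<in> green_H S \<inter> \<sigma>" "(a \<cdot> c, b \<cdot> c) \<in> green_H S \<inter> \<sigma>"
    using * c ab sg_congruence_left[OF sigma_cong, of a b c] sg_congruence_right[OF sigma_cong, of a b c]
    by (simp_all add: green_H_iff)
qed

text \<open>Members of the kernel in the quotient lift to \<open>K\<close>, the kernel of
  \<open>\<pi>\<close>. Equal identities there make the lifts \<open>\<pi>\<close>-related, through
  \<open>\<epsilon> a\<close> and \<open>\<epsilon> b\<close>. After multiplication the identities
  are \<open>\<pi>\<close>-related idempotents, and equality of traces identifies them in the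
  quotient.\<close>

lemma cryptogroup_ker_sigma_quot_lower_t:
  assumes \<pi>: "sg_congruence S \<pi>" "\<pi> \<subseteq> \<sigma>" "cong_ker S \<pi> = K"
  shows "cryptogroup (ker_sigma (quotient_sgrp S (lower_t S \<pi>)))"
proof -
  have t: "sg_congruence S (lower_t S \<pi>)" "cong_tr S (lower_t S \<pi>) = cong_tr S \<pi>" "lower_t S \<pi> \<subseteq> \<pi>"
    using lower_t_is_least[OF \<pi>(1)] \<pi>(1) unfolding is_least_congruence_def by auto
  interpret creg_quotient S "lower_t S \<pi>" by (rule quotientI[OF t(1)])
  let ?T = "quotient_sgrp S (lower_t S \<pi>)"
  let ?q = "\<lambda>a. lower_t S \<pi> `` {a}"
  have sub: "lower_t S \<pi> \<subseteq> \<sigma>" using t \<pi> by blast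
  have "idempotents ?T \<times> idempotents ?T \<subseteq> pushforward \<sigma>"
  proof clarify
    fix A B assume AB: "A \<in> idempotents ?T" "B \<in> idempotents ?T"
    obtain a where a: "a \<in> carrier S" "A = ?q a"
      using T.idempotent_carrier[OF AB(1)] by (auto simp: quot_carrier)
    obtain b where b: "b \<in> carrier S" "B = ?q b"
      using T.idempotent_carrier[OF AB(2)] by (auto simp: quot_carrier)
    have "A = ?q (\<epsilon> a)" "B = ?q (\<epsilon> b)" using AB a b proj_id by (simp_all add: T.idempotents_iff)
    then show "(A, B) \<in> pushforward \<sigma>"
      using a b pushforward_iff[OF sigma_cong sub] by (simp add: sigma_idempotents)
  qed
  \<comment> \<open>The image of \<sigma> relates all idempotents of the quotient, so it contains
    the least group congruence there; this inclusion is what lets kernel elements lift to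
    \<open>K\<close>.\<close>
  then have push: "least_group_cong ?T \<subseteq> pushforward \<sigma>"
    using T.sigma_least pushforward_cong[OF sigma_cong sub] by blast
  have lift: "\<exists>a. A = ?q a \<and> a \<in> carrier S \<and> (a, \<epsilon> a) \<in> \<pi>"
    if A: "A \<in> cong_ker ?T (least_group_cong ?T)" for A
  proof -
    obtain a where a: "a \<in> carrier S" "A = ?q a"
      using T.ker_carrier[OF A] by (auto simp: quot_carrier)
    have "(?q a, ?q (\<epsilon> a)) \<in> pushforward \<sigma>"
      using A push a proj_id by (auto simp: T.mem_ker_iff)
    then have "a \<in> K" using a pushforward_iff[OF sigma_cong sub] by (simp add: mem_ker_iff)
    then show ?thesis using a \<pi> mem_cong_ker_iff by blast
  qed
  have id_eq: "?q (\<epsilon> x) = ?q (\<epsilon> y)" if "(x, y) \<in> \<pi>" for x y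
  proof (rule proj_eqI)
    have "x \<in> carrier S" "y \<in> carrier S" using sg_congruence_carrier[OF \<pi>(1) that] by simp_all
    then have "(\<epsilon> x, \<epsilon> y) \<in> cong_tr S \<pi>"
      using sg_congruence_id[OF \<pi>(1) that] by (simp add: cong_tr_def)
    then show "(\<epsilon> x, \<epsilon> y) \<in> lower_t S \<pi>" unfolding t(2)[symmetric] by (simp add: cong_tr_def)
  qed
  show ?thesis unfolding T.cryptogroup_ker_sigma_iff
  proof (intro ballI impI)
    fix A B C assume ABC: "A \<in> cong_ker ?T (least_group_cong ?T)" "B \<in> cong_ker ?T (least_group_cong ?T)"
      "C \<in> cong_ker ?T (least_group_cong ?T)" and eq: "grp_id ?T A = grp_id ?T B"
    obtain a where a: "A = ?q a" "a \<in> carrier S" "(a, \<epsilon> a) \<in> \<pi>" using lift[OF ABC(1)] by blast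
    obtain b where b: "B = ?q b" "b \<in> carrier S" "(b, \<epsilon> b) \<in> \<pi>" using lift[OF ABC(2)] by blast
    obtain c where c: "C = ?q c" "c \<in> carrier S" using lift[OF ABC(3)] by blast
    have "(\<epsilon> a, \<epsilon> b) \<in> \<pi>" using eq a b t(3) by (auto simp: proj_id proj_eq_iff)
    then have "(a, b) \<in> \<pi>"
      using a(3) sg_congruence_sym[OF \<pi>(1) b(3)] sg_congruence_trans[OF \<pi>(1)] by blast
    then have "(c \<cdot> a, c \<cdot> b) \<in> \<pi>" "(a \<cdot> c, b \<cdot> c) \<in> \<pi>"
      using c sg_congruence_left[OF \<pi>(1)] sg_congruence_right[OF \<pi>(1)] by blast+
    then show "grp_id ?T (C \<cdot>\<^bsub>?T\<^esub> A) = grp_id ?T (C \<cdot>\<^bsub>?T\<^esub> B) \<and> grp_id ?T (A \<cdot>\<^bsub>?T\<^esub> C) = grp_id ?T (B \<cdot>\<^bsub>?T\<^esub> C)"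
      using a b c id_eq by (simp add: proj_mult proj_id)
  qed
qed

text \<open>The witness is the preimage of \<open>?h\<close>. Each element is \<H>-related to its
  identity, so intersecting with \<H> keeps the kernel of the group congruence. Idempotents related
  by \<H> coincide, so the trace falls into \<open>\<rho>\<close>.\<close>

lemma E_unitary_cong_if_cryptogroup_ker_sigma_quot:
  assumes \<rho>: "sg_congruence S \<rho>" "cryptogroup (ker_sigma (quotient_sgrp S \<rho>))"
  obtains \<tau> where "sg_congruence S \<tau>" "E_unitary (quotient_sgrp S \<tau>)" "cong_tr S \<tau> \<subseteq> \<rho>"
proof -
  interpret creg_quotient S \<rho> by (rule quotientI[OF \<rho>(1)])
  let ?T = "quotient_sgrp S \<rho>"
  let ?h = "green_H ?T \<inter> least_group_cong ?T"
  note h = T.green_H_Int_sigma_cong[OF \<rho>(2)]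
  have "cong_ker ?T ?h = cong_ker ?T (least_group_cong ?T)"
  proof (rule Set.set_eqI)
    fix A
    have "grp_id ?T (grp_id ?T A) = grp_id ?T A" if "A \<in> carrier ?T"
      using T.id_idempotent[OF that] T.idempotents_iff by blast
    then show "A \<in> cong_ker ?T ?h \<longleftrightarrow> A \<in> cong_ker ?T (least_group_cong ?T)"
      unfolding T.mem_cong_ker_iff[OF h] T.mem_ker_iff by (auto simp: T.green_H_iff)
  qed
  then have "cong_ker S (pullback ?h) = cong_ker S (pullback (least_group_cong ?T))"
    by (simp only: cong_ker_pullback[OF h] cong_ker_pullback[OF T.sigma_cong])
  moreover have "idempotents S \<times> idempotents S \<subseteq> pullback (least_group_cong ?T)"
    by (rule pullback_idempotents) (auto intro: T.sigma_idempotents)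
  ultimately have "E_unitary (quotient_sgrp S (pullback ?h))"
    by (intro creg_quotient.E_unitary_quotI[OF quotientI[OF pullback_cong[OF h]]
          pullback_cong[OF T.sigma_cong]])
  moreover have "cong_tr S (pullback ?h) \<subseteq> \<rho>"
    by (auto simp: cong_tr_def pullback_def T.green_H_iff idempotents_iff proj_id proj_eq_iff)
  ultimately show ?thesis using that pullback_cong[OF h] by blast
qed

end

theorem corollary2p8:
  fixes S :: "'a sgrp"
  assumes "completely_regular S"
  shows "lower_t S (least_E_unitary_cong S) = lower_t S (lower_k S (lower_t S (universal_cong S)))
    \<and> is_least_congruence S (\<lambda>\<rho>. cryptogroup (ker_sigma (quotient_sgrp S \<rho>)))
        (lower_t S (least_E_unitary_cong S))"
proof
  interpret creg S by unfold_locales (rule assms)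
  let ?\<sigma> = "least_group_cong S" and ?\<pi> = "least_E_unitary_cong S"
  show "lower_t S ?\<pi> = lower_t S (lower_k S (lower_t S (universal_cong S)))"
    by (simp add: least_E_unitary_cong lower_t_universal)
  \<comment> \<open>The inclusion holds because \<open>?\<sigma>\<close> is itself a candidate in
    the definition of its \<open>lower_k\<close>.\<close>
  have \<pi>: "sg_congruence S ?\<pi>" "cong_ker S ?\<pi> = cong_ker S ?\<sigma>" "?\<pi> \<subseteq> ?\<sigma>"
    using lower_k_is_least[OF sigma_cong] sigma_cong
    unfolding is_least_congruence_def least_E_unitary_cong by auto
  have "lower_t S ?\<pi> \<subseteq> \<rho>"
    if \<rho>: "sg_congruence S \<rho>" "cryptogroup (ker_sigma (quotient_sgrp S \<rho>))" for \<rho>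
  proof -
    obtain \<tau> where \<tau>: "sg_congruence S \<tau>" "E_unitary (quotient_sgrp S \<tau>)" "cong_tr S \<tau> \<subseteq> \<rho>"
      using E_unitary_cong_if_cryptogroup_ker_sigma_quot[OF \<rho>] .
    have "?\<pi> \<subseteq> \<tau>"
      using lower_k_sigma_is_least_E_unitary \<tau> unfolding is_least_congruence_def least_E_unitary_cong
      by blast
    then have "cong_tr S ?\<pi> \<subseteq> \<rho>" using \<tau>(3) by (auto simp: cong_tr_def)
    then show ?thesis by (rule lower_t_subset_if_tr_subset[OF \<pi>(1) \<rho>(1)])
  qed
  then show "is_least_congruence S (\<lambda>\<rho>. cryptogroup (ker_sigma (quotient_sgrp S \<rho>))) (lower_t S ?\<pi>)"
    using lower_t_is_least[OF \<pi>(1)] cryptogroup_ker_sigma_quot_lower_t[OF \<pi>(1,3,2)]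
    unfolding is_least_congruence_def by blast
qed

end
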